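(* Let $K\subset\mathbb{R}^2$ be a centrally symmetric convex body with $o\in\operatorname{int}K$, let $P$ be a parallelogram, and suppose $$|K|\cdot|K^*|\le(1+\varepsilon)\cdot 8,\quad\text{with } \varepsilon>0.$$ Then $\delta_{BM}(K,P)\le 1+200\,\varepsilon$. Moreover, let $x\in\mathbb{R}^2$ and $\lambda_1,\lambda_2>0$, and let $P$ be a parallelogram such that $\lambda_1P+x\subset K\subset\lambda_2P+x$ and $\lambda_2/\lambda_1\le 1+200\,\varepsilon<2$. Then, in the Euclidean norm for which $[(\lambda_1+\lambda_2)/2]P$ is a square of diameter $1$, the distance of the centre of $[(\lambda_1+\lambda_2)/2]P+x$ from $o$ is at most $336\cdot\sqrt{\varepsilon}$.
   Context: $o$ is the origin of $\mathbb{R}^2$, $\langle\cdot,\cdot\rangle$ the scalar product, $|\cdot|$ denotes area. A convex body is a compact convex set with non-empty interior. Central symmetry of $K$ is with respect to some point, not necessarily $o$. Parallelograms are understood as (closed) two-dimensional convex bodies. For a convex body $K$ with $o\in\operatorname{int}K$ the polar is $K^*=\{x\in\mathbb{R}^2:\ \langle x,y\rangle\le 1\ \text{for all } y\in K\}$. For convex bodies $K,L\subset\mathbb{R}^2$ the Banach-Mazur distance is $$\delta_{BM}(K,L)=\min\{\lambda_2/\lambda_1:\ \lambda_1,\lambda_2\in(0,\infty),\ \exists\text{ affinity }A,\ \exists x\in\mathbb{R}^2,\ \lambda_1A(K)\subset L\subset\lambda_2A(K)+x\}.$$ "The Euclidean norm for which a set is a square of diameter $1$" means the norm on $\mathbb{R}^2$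 induced by an inner product (in general different from the standard one) with respect to which the given parallelogram is a square of diameter $1$; the distance in the conclusion is measured in this norm. *)

theory Defs
  imports "HOL-Analysis.Analysis"
begin

section \<open>Convex bodies\<close>

definition convex_body :: "(real^2) set \<Rightarrow> bool" where
  "convex_body K \<longleftrightarrow> compact K \<and> convex K \<and> interior K \<noteq> {}"

definition symmetric_about :: "real^2 \<Rightarrow> (real^2) set \<Rightarrow> bool" where
  "symmetric_about c S \<longleftrightarrow> (\<forall>y\<in>S. 2 *\<^sub>R c - y \<in> S)"

definition centrally_symmetric :: "(real^2) set \<Rightarrow> bool" where
  "centrally_symmetric S \<longleftrightarrow> (\<exists>c. symmetric_about c S)"

definition polar_body :: "(real^2) set \<Rightarrow> (real^2) set" where
  "polar_body K = {x. \<forall>y\<in>K. x \<bullet> y \<le> 1}"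

definition area :: "(real^2) set \<Rightarrow> real" where
  "area S = measure lebesgue S"

text \<open>Affinities are the invertible affine maps of the plane.\<close>

definition affinity :: "(real^2 \<Rightarrow> real^2) \<Rightarrow> bool" where
  "affinity A \<longleftrightarrow> (\<exists>f b. linear f \<and> bij f \<and> A = (\<lambda>y. f y + b))"

definition bm_ratios :: "(real^2) set \<Rightarrow> (real^2) set \<Rightarrow> real set" where
  "bm_ratios K L = {l2 / l1 | l1 l2. 0 < l1 \<and> 0 < l2 \<and>
     (\<exists>A x. affinity A \<and> (*\<^sub>R) l1 ` A ` K \<subseteq> L \<and> L \<subseteq> (+) x ` (*\<^sub>R) l2 ` A ` K)}"

text \<open>For convex bodies the infimum is a minimum, see \<open>banach_mazur_minimum\<close> below.\<close>

definition banach_mazur :: "(real^2) set \<Rightarrow> (real^2) set \<Rightarrow> real" where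
  "banach_mazur K L = Inf (bm_ratios K L)"


section \<open>Parallelograms, and squares in a Euclidean structure\<close>

definition parallelogram_at :: "real^2 \<Rightarrow> real^2 \<Rightarrow> real^2 \<Rightarrow> (real^2) set" where
  "parallelogram_at a u v = {a + s *\<^sub>R u + t *\<^sub>R v | s t. s \<in> {0..1} \<and> t \<in> {0..1}}"

definition parallelogram :: "(real^2) set \<Rightarrow> bool" where
  "parallelogram P \<longleftrightarrow> (\<exists>a u v. u \<noteq> v \<and> independent {u, v} \<and> P = parallelogram_at a u v)"

definition inner_product :: "(real^2 \<Rightarrow> real^2 \<Rightarrow> real) \<Rightarrow> bool" where
  "inner_product B \<longleftrightarrow>
     bilinear B \<and> (\<forall>x y. B x y = B y x) \<and> (\<forall>x. x \<noteq> 0 \<longrightarrow> 0 < B x x)"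

definition induced_norm :: "(real^2 \<Rightarrow> real^2 \<Rightarrow> real) \<Rightarrow> real^2 \<Rightarrow> real" where
  "induced_norm B x = sqrt (B x x)"

definition square_wrt :: "(real^2 \<Rightarrow> real^2 \<Rightarrow> real) \<Rightarrow> (real^2) set \<Rightarrow> bool" where
  "square_wrt B S \<longleftrightarrow> (\<exists>a u v. u \<noteq> 0 \<and> B u v = 0 \<and>
     induced_norm B u = induced_norm B v \<and> S = parallelogram_at a u v)"

definition diameter_wrt :: "(real^2 \<Rightarrow> real^2 \<Rightarrow> real) \<Rightarrow> (real^2) set \<Rightarrow> real" where
  "diameter_wrt B S = (SUP (x, y) \<in> S \<times> S. induced_norm B (x - y))"


section \<open>The Banach-Mazur infimum is attained\<close>

lemma bm_ratios_iff:
  "r \<in> bm_ratios K L \<longleftrightarrow> 0 < r \<and> (\<exists>f b z. linear f \<and> bij f \<and>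
     (\<forall>y\<in>K. f y + b \<in> L) \<and> (\<forall>w\<in>L. \<exists>y\<in>K. w = r *\<^sub>R f y + z))"
  (is "?lhs \<longleftrightarrow> ?rhs")
proof
  assume ?lhs
  then obtain l1 l2 f b x where r: "r = l2 / l1" "0 < l1" "0 < l2" and f: "linear f" "bij f"
    and i1: "(*\<^sub>R) l1 ` (\<lambda>y. f y + b) ` K \<subseteq> L"
    and i2: "L \<subseteq> (+) x ` (*\<^sub>R) l2 ` (\<lambda>y. f y + b) ` K"
    unfolding bm_ratios_def affinity_def by blast
  have lin: "linear (\<lambda>y. l1 *\<^sub>R f y)"
    using f(1) by (rule linear_compose_scale_right)
  moreover have "bij (\<lambda>y. l1 *\<^sub>R f y)"
  proof -
    have "inj (\<lambda>y. l1 *\<^sub>R f y)"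
      using f(2) r(2) by (auto simp: inj_on_def bij_def)
    then show ?thesis
      using lin by (simp add: bij_def linear_injective_imp_surjective)
  qed
  moreover have "\<forall>y\<in>K. l1 *\<^sub>R f y + l1 *\<^sub>R b \<in> L"
    using i1 by (auto simp: scaleR_add_right image_subset_iff)
  moreover have "\<exists>y\<in>K. w = r *\<^sub>R (l1 *\<^sub>R f y) + (x + l2 *\<^sub>R b)" if "w \<in> L" for w
    using i2 that r by (fastforce simp: scaleR_add_right)
  moreover have "0 < r"
    using r by simp
  ultimately show ?rhs
    by blast
next
  assume ?rhs
  then obtain f b z where r: "0 < r" and f: "linear f" "bij f"
    and i1: "\<forall>y\<in>K. f y + b \<in> L" and i2: "\<forall>w\<in>L. \<exists>y\<in>K. w = r *\<^sub>R f y + z" by blast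
  have "affinity (\<lambda>y. f y + b)"
    using f unfolding affinity_def by blast
  moreover have "(*\<^sub>R) 1 ` (\<lambda>y. f y + b) ` K \<subseteq> L"
    using i1 by auto
  moreover have "L \<subseteq> (+) (z - r *\<^sub>R b) ` (*\<^sub>R) r ` (\<lambda>y. f y + b) ` K"
  proof
    fix w assume "w \<in> L"
    then obtain y where "y \<in> K" "w = (z - r *\<^sub>R b) + r *\<^sub>R (f y + b)"
      using i2 by (auto simp: scaleR_add_right)
    then show "w \<in> (+) (z - r *\<^sub>R b) ` (*\<^sub>R) r ` (\<lambda>y. f y + b) ` K" by blast
  qed
  ultimately have "\<exists>A x. affinity A \<and> (*\<^sub>R) 1 ` A ` K \<subseteq> L \<and> L \<subseteq> (+) x ` (*\<^sub>R) r ` A ` K"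
    by (intro exI conjI)
  moreover have "r = r / 1" "(0::real) < 1"
    by simp_all
  ultimately show ?lhs
    unfolding bm_ratios_def mem_Collect_eq using r by (intro exI[of _ 1] exI[of _ r] conjI)
qed

lemma bm_ratios_nonempty:
  assumes "convex_body K" "convex_body L"
  shows "bm_ratios K L \<noteq> {}"
proof -
  obtain a \<rho> where K: "0 < \<rho>" "ball a \<rho> \<subseteq> K"
    using assms(1) unfolding convex_body_def by (meson ex_in_conv mem_interior)
  obtain c \<sigma> where L: "0 < \<sigma>" "ball c \<sigma> \<subseteq> L"
    using assms(2) unfolding convex_body_def by (meson ex_in_conv mem_interior)
  obtain R where R: "0 < R" "\<And>y. y \<in> K \<Longrightarrow> norm (y - a) < R"
    using bounded_subset_ballD[OF compact_imp_bounded, of K a] assms(1)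
    by (auto simp: convex_body_def subset_iff dist_norm norm_minus_commute)
  obtain R' where R': "0 < R'" "\<And>y. y \<in> L \<Longrightarrow> norm (y - c) < R'"
    using bounded_subset_ballD[OF compact_imp_bounded, of L c] assms(2)
    by (auto simp: convex_body_def subset_iff dist_norm norm_minus_commute)
  define q where "q = \<sigma> / R"
  define r where "r = R' / (\<rho> * q)"
  have q: "0 < q" and r: "0 < r" using K L R R' by (auto simp: q_def r_def)
  have lin: "linear (\<lambda>y::real^2. q *\<^sub>R y)"
    by (simp add: linear_scale_self)
  have "bij (\<lambda>y::real^2. q *\<^sub>R y)"
    using lin q linear_injective_imp_surjective[OF lin] by (auto simp: bij_def inj_on_def)
  moreover have "q *\<^sub>R y + (c - q *\<^sub>R a) \<in> L" if "y \<in> K" for y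
  proof -
    have "dist c (q *\<^sub>R y + (c - q *\<^sub>R a)) = q * norm (y - a)"
      using q by (simp add: dist_norm norm_minus_commute flip: scaleR_diff_right)
    also have "\<dots> < q * R" using R(2)[OF that] q by simp
    also have "\<dots> = \<sigma>" using R by (simp add: q_def)
    finally show ?thesis using L by auto
  qed
  moreover have "\<exists>y\<in>K. w = r *\<^sub>R (q *\<^sub>R y) + (c - (r * q) *\<^sub>R a)" if "w \<in> L" for w
  proof
    let ?y = "a + (1 / (r * q)) *\<^sub>R (w - c)"
    have "dist a ?y = norm (w - c) / (r * q)"
      using q r by (simp add: dist_norm)
    also have "\<dots> < R' / (r * q)" using R'(2)[OF that] q r by (simp add: divide_strict_right_mono)
    also have "\<dots> = \<rho>" using q K R' by (simp add: r_def)
    finally show "?y \<in> K" using K by auto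
    show "w = r *\<^sub>R (q *\<^sub>R ?y) + (c - (r * q) *\<^sub>R a)"
      using q r by (simp add: scaleR_add_right)
  qed
  ultimately have "r \<in> bm_ratios K L"
    unfolding bm_ratios_iff using lin r by blast
  then show ?thesis by blast
qed

lemma negligible_not_convex_body:
  assumes "convex_body L" shows "\<not> negligible L"
  using assms interior_subset open_interior open_not_negligible negligible_subset
  unfolding convex_body_def by metis

text \<open>A linear map is given by the images \<open>p\<close>, \<open>q\<close> of the two unit vectors.\<close>

abbreviation (input) lin2 :: "real^2 \<Rightarrow> real^2 \<Rightarrow> real^2 \<Rightarrow> real^2" where
  "lin2 p q y \<equiv> (y $ 1) *\<^sub>R p + (y $ 2) *\<^sub>R q"

lemma linear_lin2: "linear (\<lambda>y. lin2 p q y)"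
  by (rule linearI) (auto simp: algebra_simps)

lemma linear_eq_lin2:
  assumes "linear f" shows "f y = lin2 (f (axis 1 1)) (f (axis 2 1)) y"
proof -
  have "y = (y $ 1) *\<^sub>R axis 1 1 + (y $ 2) *\<^sub>R axis 2 1"
    by (simp add: vec_eq_iff forall_2 axis_def)
  then have "f y = f ((y $ 1) *\<^sub>R axis 1 1 + (y $ 2) *\<^sub>R axis 2 1)"
    by simp
  then show ?thesis
    using assms by (simp only: linear_add linear_scale)
qed

lemma banach_mazur_attained:
  assumes K: "convex_body K" and L: "convex_body L"
  shows "\<exists>r\<in>bm_ratios K L. \<forall>r'\<in>bm_ratios K L. r \<le> r'"
proof -
  obtain r0 where r0: "r0 \<in> bm_ratios K L"
    using bm_ratios_nonempty[OF assms] by blast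
  have cK: "compact K" and cL: "compact L" using K L by (auto simp: convex_body_def)
  define T :: "((real^2) \<times> (real^2) \<times> (real^2) \<times> (real^2) \<times> real) set" where
    "T = {(p, q, b, z, r). 0 \<le> r \<and> r \<le> r0 \<and> (\<forall>y\<in>K. lin2 p q y + b \<in> L) \<and>
                    (\<forall>w\<in>L. \<exists>y\<in>K. w = r *\<^sub>R lin2 p q y + z)}"
  have mem: "\<exists>p q b z. (p, q, b, z, r) \<in> T" if "r \<in> bm_ratios K L" "r \<le> r0" for r
  proof -
    note h = iffD1[OF bm_ratios_iff that(1)]
    have "0 < r"
      using h by (rule conjunct1)
    obtain f b z where fbz: "linear f \<and> bij f \<and>
        (\<forall>y\<in>K. f y + b \<in> L) \<and> (\<forall>w\<in>L. \<exists>y\<in>K. w = r *\<^sub>R f y + z)"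
      using conjunct2[OF h] by (elim exE) (rule that)
    have f: "linear f"
      using fbz by (rule conjunct1)
    have i1: "\<forall>y\<in>K. f y + b \<in> L"
      using fbz by (elim conjE)
    have i2: "\<forall>w\<in>L. \<exists>y\<in>K. w = r *\<^sub>R f y + z"
      using fbz by (elim conjE)
    define p q where "p = f (axis 1 1)" and "q = f (axis 2 1)"
    have f_eq: "f y = lin2 p q y" for y
      unfolding p_def q_def using f by (rule linear_eq_lin2)
    have "(p, q, b, z, r) \<in> T"
      using \<open>0 < r\<close> that(2) i1 i2 unfolding T_def f_eq by simp
    then show ?thesis by blast
  qed
  have ratio: "r \<in> bm_ratios K L" if "(p, q, b, z, r) \<in> T" for p q b z r
  proof -
    let ?f = "\<lambda>y. lin2 p q y"
    have i1: "\<forall>y\<in>K. ?f y + b \<in> L" and i2: "\<forall>w\<in>L. \<exists>y\<in>K. w = r *\<^sub>R ?f y + z" and "0 \<le> r"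
      using that by (auto simp: T_def)
    let ?g = "\<lambda>y. r *\<^sub>R ?f y"
    have g: "linear ?g" using linear_lin2 by (rule linear_compose_scale_right)
    have "inj ?g"
    proof (rule ccontr)
      assume "\<not> inj ?g"
      then have "negligible ((+) z ` ?g ` K)"
        using g negligible_linear_singular_image negligible_translation by blast
      moreover have "L \<subseteq> (+) z ` ?g ` K"
      proof
        fix w assume "w \<in> L"
        then obtain y where y: "y \<in> K" "w = ?g y + z" using i2 by blast
        show "w \<in> (+) z ` ?g ` K"
          unfolding y(2) add.commute[of _ z] using y(1) by (intro imageI)
      qed
      ultimately show False
        using negligible_not_convex_body[OF L] negligible_subset by blast
    qed
    have "r \<noteq> 0"
    proof
      assume "r = 0"
      then show False
        using injD[OF \<open>inj ?g\<close>, of 0 1] by simp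
    qed
    have "inj ?f"
    proof (rule injI)
      fix y y' assume "?f y = ?f y'"
      then have "?g y = ?g y'" by (rule arg_cong)
      then show "y = y'" by (rule injD[OF \<open>inj ?g\<close>])
    qed
    then have "bij ?f"
      unfolding bij_def by (intro conjI linear_inj_imp_surj linear_lin2)
    moreover have "0 < r"
      using \<open>r \<noteq> 0\<close> \<open>0 \<le> r\<close> by simp
    ultimately show ?thesis
      unfolding bm_ratios_iff using i1 i2 linear_lin2
      by (intro conjI exI[of _ ?f] exI[of _ b] exI[of _ z]) 
  qed
  have "closed T"
    unfolding closed_sequential_limits
  proof (intro allI impI, elim conjE)
    fix X l assume X: "\<forall>n. X n \<in> T" and lim: "X \<longlonglongrightarrow> l"
    obtain p q b z r where l: "l = (p, q, b, z, r)" by (cases l)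
    define P where "P n = fst (X n)" for n
    define Q where "Q n = fst (snd (X n))" for n
    define B where "B n = fst (snd (snd (X n)))" for n
    define Z where "Z n = fst (snd (snd (snd (X n))))" for n
    define R where "R n = snd (snd (snd (snd (X n))))" for n
    have "X n = (P n, Q n, B n, Z n, R n)" for n
      by (simp add: P_def Q_def B_def Z_def R_def)
    then have in_T: "(P n, Q n, B n, Z n, R n) \<in> T" for n using X by metis
    have lims: "P \<longlonglongrightarrow> p" "Q \<longlonglongrightarrow> q" "B \<longlonglongrightarrow> b" "Z \<longlonglongrightarrow> z" "R \<longlonglongrightarrow> r"
      using tendsto_fst[OF lim] tendsto_fst[OF tendsto_snd[OF lim]]
        tendsto_fst[OF tendsto_snd[OF tendsto_snd[OF lim]]]
        tendsto_fst[OF tendsto_snd[OF tendsto_snd[OF tendsto_snd[OF lim]]]]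
        tendsto_snd[OF tendsto_snd[OF tendsto_snd[OF tendsto_snd[OF lim]]]]
      by (simp_all add: l P_def[abs_def] Q_def[abs_def] B_def[abs_def] Z_def[abs_def] R_def[abs_def])
    have "0 \<le> r" "r \<le> r0"
      using in_T LIMSEQ_le_const[OF lims(5), of 0] LIMSEQ_le_const2[OF lims(5), of r0]
      by (auto simp: T_def)
    moreover have "lin2 p q y + b \<in> L" if "y \<in> K" for y
    proof (rule closed_sequentially[OF compact_imp_closed[OF cL]])
      show "lin2 (P n) (Q n) y + B n \<in> L" for n using in_T that by (auto simp: T_def)
      show "(\<lambda>n. lin2 (P n) (Q n) y + B n) \<longlonglongrightarrow> lin2 p q y + b"
        by (intro tendsto_intros lims)
    qed
    moreover have "\<exists>y\<in>K. w = r *\<^sub>R lin2 p q y + z" if "w \<in> L" for w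
    proof -
      have "\<forall>n. \<exists>y\<in>K. w = R n *\<^sub>R lin2 (P n) (Q n) y + Z n"
        using in_T that by (auto simp: T_def)
      then obtain Y where Y: "\<And>n. Y n \<in> K" "\<And>n. w = R n *\<^sub>R lin2 (P n) (Q n) (Y n) + Z n"
        by metis
      obtain y \<phi> where y: "y \<in> K" "strict_mono (\<phi> :: nat \<Rightarrow> nat)" "(Y \<circ> \<phi>) \<longlonglongrightarrow> y"
        using cK Y(1) unfolding compact_def by metis
      have sub: "(\<lambda>n. P (\<phi> n)) \<longlonglongrightarrow> p" "(\<lambda>n. Q (\<phi> n)) \<longlonglongrightarrow> q" "(\<lambda>n. Z (\<phi> n)) \<longlonglongrightarrow> z"
        "(\<lambda>n. R (\<phi> n)) \<longlonglongrightarrow> r" "(\<lambda>n. Y (\<phi> n)) \<longlonglongrightarrow> y"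
        using lims y by (auto simp: o_def dest: LIMSEQ_subseq_LIMSEQ)
      have "(\<lambda>n. R (\<phi> n) *\<^sub>R lin2 (P (\<phi> n)) (Q (\<phi> n)) (Y (\<phi> n)) + Z (\<phi> n))
              \<longlonglongrightarrow> r *\<^sub>R lin2 p q y + z"
        by (intro tendsto_intros sub)
      then have "(\<lambda>n. w) \<longlonglongrightarrow> r *\<^sub>R lin2 p q y + z"
        by (simp only: Y(2)[symmetric])
      then have "w = r *\<^sub>R lin2 p q y + z"
        by (rule LIMSEQ_unique[OF tendsto_const])
      then show ?thesis using y(1) by blast
    qed
    ultimately show "l \<in> T" by (simp add: T_def l)
  qed
  moreover have "bounded T"
  proof -
    obtain a \<rho> where a: "0 < \<rho>" "ball a \<rho> \<subseteq> K"
      using K unfolding convex_body_def by (meson ex_in_conv mem_interior)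
    obtain D where D: "\<And>y. y \<in> K \<Longrightarrow> norm y \<le> D"
      using compact_imp_bounded[OF cK] by (auto simp: bounded_iff)
    obtain E where E: "\<And>y. y \<in> L \<Longrightarrow> norm y \<le> E"
      using compact_imp_bounded[OF cL] by (auto simp: bounded_iff)
    obtain w where w: "w \<in> L"
      using L unfolding convex_body_def using interior_subset by fastforce
    have aK: "a \<in> K" using a by auto
    define M where "M = 4 * E / \<rho>"
    define N where "N = D * M + D * M"
    have bnd: "norm p \<le> M \<and> norm q \<le> M \<and> norm b \<le> E + N \<and> norm z \<le> E + r0 * N \<and> norm r \<le> r0"
      if "(p, q, b, z, r) \<in> T" for p q b z r
    proof -
      let ?f = "\<lambda>y. lin2 p q y"
      have i1: "\<And>y. y \<in> K \<Longrightarrow> ?f y + b \<in> L" and i2: "\<And>w. w \<in> L \<Longrightarrow> \<exists>y\<in>K. w = r *\<^sub>R ?f y + z"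
        and r: "0 \<le> r" "r \<le> r0" using that by (auto simp: T_def)
      have unit: "norm (?f e) \<le> M" if "norm e = 1" for e
      proof -
        have "dist a (a + (\<rho> / 2) *\<^sub>R e) < \<rho>" using a that by (simp add: dist_norm)
        then have "a + (\<rho> / 2) *\<^sub>R e \<in> K" using a by auto
        then have 1: "norm (?f (a + (\<rho> / 2) *\<^sub>R e) + b) \<le> E" "norm (?f a + b) \<le> E"
          using i1 E aK by blast+
        have "(\<rho> / 2) *\<^sub>R ?f e = (?f (a + (\<rho> / 2) *\<^sub>R e) + b) - (?f a + b)"
          by (simp add: algebra_simps)
        then have "norm ((\<rho> / 2) *\<^sub>R ?f e) \<le> E + E"
          by (simp only:) (rule order_trans[OF norm_triangle_ineq4 add_mono[OF 1]])
        then have "\<rho> / 2 * norm (?f e) \<le> 2 * E" 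
          using a by (simp only: norm_scaleR)
        then show ?thesis using a by (simp add: M_def field_simps)
      qed
      have p: "norm p \<le> M" using unit[OF norm_axis_1[of 1]] by (simp add: axis_def)
      have q: "norm q \<le> M" using unit[OF norm_axis_1[of 2]] by (simp add: axis_def)
      have f: "norm (?f y) \<le> N" if "y \<in> K" for y
      proof -
        have "\<bar>y $ i\<bar> \<le> D" for i using D[OF that] component_le_norm_cart[of y i] by linarith
        then have "\<bar>y $ 1\<bar> * norm p \<le> D * M" "\<bar>y $ 2\<bar> * norm q \<le> D * M"
          using p q by (auto intro!: mult_mono order_trans[OF norm_ge_zero D[OF aK]])
        then show ?thesis
          unfolding N_def using norm_triangle_ineq[of "(y$1) *\<^sub>R p" "(y$2) *\<^sub>R q"] by simp
      qed
      have "norm b \<le> norm (?f a + b) + norm (?f a)"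
        by (metis add_diff_cancel_left' norm_triangle_ineq4)
      then have b: "norm b \<le> E + N" using f[OF aK] E[OF i1[OF aK]] by linarith
      obtain y where y: "y \<in> K" "w = r *\<^sub>R ?f y + z" using i2[OF w] by blast
      have "norm z \<le> norm w + norm (r *\<^sub>R ?f y)"
        using y(2) by (metis add_diff_cancel_left' norm_triangle_ineq4)
      moreover have "norm (r *\<^sub>R ?f y) \<le> r0 * N"
        unfolding norm_scaleR using r f[OF y(1)] by (auto intro!: mult_mono)
      ultimately have "norm z \<le> E + r0 * N" using E[OF w] by linarith
      then show ?thesis using p q b r by simp
    qed
    have "T \<subseteq> cball 0 M \<times> cball 0 M \<times> cball 0 (E + N) \<times> cball 0 (E + r0 * N) \<times> cball 0 r0"
      using bnd by (auto simp: mem_cball dist_norm)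
    then show ?thesis
      by (rule bounded_subset[rotated]) (intro bounded_Times bounded_cball)
  qed
  ultimately have "compact T" by (simp add: compact_eq_bounded_closed)
  moreover have "T \<noteq> {}" using mem[OF r0] by blast
  moreover have "continuous_on T (\<lambda>t. snd (snd (snd (snd t))))"
    by (intro continuous_intros)
  ultimately obtain t where t: "t \<in> T" "\<forall>s\<in>T. snd (snd (snd (snd t))) \<le> snd (snd (snd (snd s)))"
    by (metis continuous_attains_inf)
  obtain p q b z r where tt: "t = (p, q, b, z, r)" by (cases t)
  have "r \<in> bm_ratios K L" using ratio t(1) tt by blast
  moreover have "r \<le> r'" if "r' \<in> bm_ratios K L" for r'
  proof (cases "r' \<le> r0")
    case True
    then show ?thesis using mem[OF that] t(2) tt by force
  next
    case False
    then show ?thesis using t(1) by (auto simp: T_def tt)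
  qed
  ultimately show ?thesis by blast
qed

theorem banach_mazur_minimum:
  assumes "convex_body K" "convex_body L"
  shows "banach_mazur K L \<in> bm_ratios K L" "\<And>r. r \<in> bm_ratios K L \<Longrightarrow> banach_mazur K L \<le> r"
proof -
  obtain r where r: "r \<in> bm_ratios K L" "\<forall>r'\<in>bm_ratios K L. r \<le> r'"
    using banach_mazur_attained[OF assms] by blast
  then have "banach_mazur K L = r"
    unfolding banach_mazur_def by (intro cInf_eq_minimum) auto
  then show "banach_mazur K L \<in> bm_ratios K L" "\<And>r. r \<in> bm_ratios K L \<Longrightarrow> banach_mazur K L \<le> r"
    using r by auto
qed

text \<open>Every parallelogram is a square of diameter one for some inner product, so quantifying
  over such inner products is not vacuous.\<close>

lemma parallelogram_unit_square:
  assumes "parallelogram P"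
  shows "\<exists>B. inner_product B \<and> square_wrt B P \<and> diameter_wrt B P = 1"
proof -
  obtain a u v where uv: "u \<noteq> v" "independent {u, v}" and P: "P = parallelogram_at a u v"
    using assms unfolding parallelogram_def by blast
  have inj0: "y = 0" if "lin2 u v y = 0" for y
  proof -
    have "(\<Sum>x\<in>{u, v}. (if x = u then y $ 1 else y $ 2) *\<^sub>R x) = 0"
      using uv(1) that by simp
    then have "\<forall>x\<in>{u, v}. (if x = u then y $ 1 else y $ 2) = 0"
      by (rule mp[OF spec[OF conjunct2[OF uv(2)[unfolded independent_explicit]]]])
    then have "y $ 1 = 0" "y $ 2 = 0"
      using uv(1) by auto
    then show ?thesis
      by (simp add: vec_eq_iff forall_2)
  qed
  define F where "F y = lin2 u v y" for y
  have F: "linear F"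
    unfolding F_def by (rule linear_lin2)
  have "inj F"
    unfolding linear_injective_0[OF F] by (intro allI impI, rule inj0) (simp add: F_def)
  with F obtain g where g: "linear g" "\<And>y. g (F y) = y" "\<And>x. F (g x) = x"
    using linear_injective_isomorphism[of F] by blast
  have gu: "g u = axis 1 1" using g(2)[of "axis 1 1"] by (simp add: F_def axis_def)
  have gv: "g v = axis 2 1" using g(2)[of "axis 2 1"] by (simp add: F_def axis_def)
  define B where "B x y = (g x \<bullet> g y) / 2" for x y
  have "inner_product B"
    unfolding inner_product_def bilinear_def
  proof (intro conjI allI impI)
    show "linear (B x)" "linear (\<lambda>x. B x y)" for x y
      using g(1) by (auto intro!: linearI simp: B_def linear_add linear_scale inner_simps add_divide_distrib)
    show "B x y = B y x" for x y
      by (simp add: B_def inner_commute)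
    show "0 < B x x" if "x \<noteq> 0" for x
    proof -
      have "g x \<noteq> 0" using g(3)[of x] that by (auto simp: F_def)
      then show ?thesis by (simp add: B_def)
    qed
  qed
  moreover have "square_wrt B P"
  proof -
    have "u \<noteq> 0" using uv(2) dependent_zero by blast
    moreover have "B u v = 0" by (simp add: B_def gu gv inner_axis_axis)
    moreover have "induced_norm B u = induced_norm B v"
      by (simp add: induced_norm_def B_def gu gv inner_axis_axis)
    ultimately show ?thesis unfolding square_wrt_def P by blast
  qed
  moreover have "diameter_wrt B P = 1"
  proof -
    have val: "induced_norm B (s *\<^sub>R u + t *\<^sub>R v) = sqrt ((s\<^sup>2 + t\<^sup>2) / 2)" for s t
    proof -
      have "g (s *\<^sub>R u + t *\<^sub>R v) = s *\<^sub>R axis 1 1 + t *\<^sub>R axis 2 1"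
        using g(1) by (simp add: linear_add linear_scale gu gv)
      then show ?thesis
        by (simp add: induced_norm_def B_def inner_axis_axis inner_simps power2_eq_square)
    qed
    have le: "induced_norm B (x - y) \<le> 1" if "x \<in> P" "y \<in> P" for x y
    proof -
      obtain s t where x: "s \<in> {0..1}" "t \<in> {0..1}" "x = a + s *\<^sub>R u + t *\<^sub>R v"
        using \<open>x \<in> P\<close> unfolding P parallelogram_at_def by auto
      obtain s' t' where y: "s' \<in> {0..1}" "t' \<in> {0..1}" "y = a + s' *\<^sub>R u + t' *\<^sub>R v"
        using \<open>y \<in> P\<close> unfolding P parallelogram_at_def by auto
      have "x - y = (s - s') *\<^sub>R u + (t - t') *\<^sub>R v"
        unfolding x(3) y(3) by (simp add: algebra_simps)
      moreover have "(s - s')\<^sup>2 \<le> 1" "(t - t')\<^sup>2 \<le> 1"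
        using x(1,2) y(1,2) by (simp_all add: abs_square_le_1 abs_le_iff)
      ultimately show ?thesis by (simp add: val)
    qed
    have "a + s *\<^sub>R u + t *\<^sub>R v \<in> P" if "s \<in> {0..1}" "t \<in> {0..1}" for s t
      unfolding P parallelogram_at_def using that by blast
    from this[of 1 1] this[of 0 0]
    have mem: "a + 1 *\<^sub>R u + 1 *\<^sub>R v \<in> P" "a + 0 *\<^sub>R u + 0 *\<^sub>R v \<in> P"
      by simp_all
    have "induced_norm B ((a + 1 *\<^sub>R u + 1 *\<^sub>R v) - (a + 0 *\<^sub>R u + 0 *\<^sub>R v)) = 1"
      using val[of 1 1] by simp
    then have "1 \<in> (\<lambda>(x, y). induced_norm B (x - y)) ` (P \<times> P)"
      using mem by force
    then show ?thesis
      unfolding diameter_wrt_def using le by (intro cSup_eq_maximum) auto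
  qed
  ultimately show ?thesis by blast
qed

end

theory Submission
  imports Defs
begin

text \<open>
  The planar Mahler inequality \<open>|K| |K\<^sup>*| \<ge> 8\<close> for bodies symmetric about the origin has a short proof,
  and stability comes from following its equality cases. Choose coordinates in which an inscribed
  parallelogram of maximal area has the vertices \<open>(\<plusminus>1, 0)\<close>, \<open>(0, \<plusminus>1)\<close>; then \<open>K\<close> and \<open>L = K\<^sup>*\<close> both lie
  between the cross-polytope and the square of side \<open>2\<close> (\<open>normal_position\<close>). Let \<open>A\<close>, \<open>B\<close> be the
  areas of the parts of \<open>K\<close>, \<open>L\<close> in a quadrant, say the first one. A point \<open>x\<close> of \<open>K\<close> there spans
  with \<open>(1, 0)\<close>, \<open>(0, 1)\<close> and the origin a quadrilateral of area \<open>(x\<^sub>1 + x\<^sub>2) / 2\<close>. So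
  \<open>x\<^sub>1 + x\<^sub>2 \<le> 2 A\<close> on \<open>K\<close>, that is, \<open>(1, 1) / (2 A)\<close> belongs to \<open>L\<close>; applied to this point of
  \<open>L\<close>, the same bound gives \<open>A B \<ge> 1 / 2\<close> (\<open>quadrant_product_ge\<close>). Adjacent quadrants are combined
  by the Cauchy-Schwarz inequality (\<open>dual_pair_mahler\<close>).

  If the volume product is at most \<open>8 (1 + \<epsilon>)\<close>, then \<open>A B\<close> is within \<open>O(\<epsilon>)\<close> of \<open>1 / 2\<close> in each quadrant,
  so that both parts nearly coincide with quadrilaterals. But the dual of such a quadrilateral is
  a pentagon, unless the quadrilateral is a triangle or a square; this forces the maximum of \<open>x\<^sub>1 + x\<^sub>2\<close> on
  \<open>K\<close> to lie within \<open>O(\<epsilon>)\<close> of \<open>1\<close> or of \<open>2\<close> (\<open>quadrant_stability\<close>). Adjacent quadrants fall into the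
  same case, so \<open>K\<close> is close to the cross-polytope or to the square (\<open>dual_pair_stability\<close>).

  A centre other than the origin is treated by comparing polars. With the origin moved by \<open>z\<close> from
  the centre, the polar arises from the polar \<open>L\<close> of the centred body by a projective map, and its
  area is the integral of \<open>(1 - z \<bullet> x)\<^sup>-\<^sup>3\<close> over \<open>L\<close>. Since \<open>L\<close> is symmetric, this is at least the integral
  of \<open>1 + 6 (z \<bullet> x)\<^sup>2\<close> (\<open>area_polar_shift_ge\<close>). Hence centring only decreases the volume product, which
  reduces the first claim to bodies symmetric about the origin; and the quadratic growth,
  compared with Mahler's lower bound \<open>8\<close> for the centred body, bounds \<open>z\<close> by a multiple of \<open>sqrt \<epsilon>\<close>. As the centre of \<open>K\<close> differs from that of the
  parallelogram only by \<open>O(\<epsilon>)\<close>, the second claim follows (\<open>centre_offset_bound\<close>).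
\<close>

section \<open>Areas of convex polygons\<close>

definition cross :: "real^2 \<Rightarrow> real^2 \<Rightarrow> real" where
  "cross a b = a $ 1 * b $ 2 - a $ 2 * b $ 1"

lemma inner_plane: "x \<bullet> y = x $ 1 * y $ 1 + x $ 2 * y $ 2" for x y :: "real^2"
  by (simp add: inner_vec_def sum_2)

text \<open>Half-planes through the origin suffice, because every dissection below is by rays from the origin.\<close>

lemma measure_separated_le:
  fixes a :: "real^2"
  assumes S: "S \<in> lmeasurable" and A: "A \<in> lmeasurable" "A \<subseteq> S" "\<And>x. x \<in> A \<Longrightarrow> a \<bullet> x \<le> 0"
    and B: "B \<in> lmeasurable" "B \<subseteq> S" "\<And>x. x \<in> B \<Longrightarrow> 0 \<le> a \<bullet> x" and a: "a \<noteq> 0"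
  shows "area A + area B \<le> area S"
proof -
  have "negligible (A \<inter> B)"
  proof (rule negligible_subset[OF negligible_hyperplane])
    show "a \<noteq> 0 \<or> (0::real) \<noteq> 0" using a by simp
    show "A \<inter> B \<subseteq> {x. a \<bullet> x = 0}" using A(3) B(3) by force
  qed
  then have "measure lebesgue (A \<inter> B) = 0"
    by (rule negligible_imp_measure0)
  then have "area A + area B = measure lebesgue (A \<union> B)"
    unfolding area_def using A(1) B(1) by (simp add: measure_Un3)
  also have "\<dots> \<le> area S"
    unfolding area_def using A B S by (intro measure_mono_fmeasurable) auto
  finally show ?thesis .
qed

lemma area_triangle: "area (convex hull {0, p, q}) = \<bar>cross p q\<bar> / 2"
proof -
  have "area (convex hull {0, p, q}) = measure lborel (convex hull {0, p, q})"
    unfolding area_def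
    by (rule measure_completion) (simp add: borel_compact compact_convex_hull)
  then show ?thesis
    by (simp add: content_triangle cross_def abs_minus_commute algebra_simps)
qed

lemma lmeasurable_triangle: "convex hull {0, p, q :: real^2} \<in> lmeasurable"
  by (simp add: compact_convex_hull lmeasurable_compact)

lemma triangle_halfplane:
  fixes p q :: "real^2"
  assumes "a \<bullet> p \<le> 0" "a \<bullet> q \<le> 0" "x \<in> convex hull {0, p, q}"
  shows "a \<bullet> x \<le> 0"
proof -
  have "convex hull {0, p, q} \<subseteq> {x. a \<bullet> x \<le> 0}"
    using assms by (intro hull_minimal) (auto simp: convex_halfspace_le)
  then show ?thesis using assms by auto
qed

text \<open>Every lower bound for an area below comes from this one: triangles with a common vertex in
  counterclockwise order do not overlap, because the rays through \<open>q\<close> and \<open>r\<close> separate them.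
  Repeated points give fans of one or two triangles.\<close>

lemma area_fan_le:
  assumes S: "S \<in> lmeasurable" "convex S" "0 \<in> S" "p \<in> S" "q \<in> S" "r \<in> S" "s \<in> S"
    and nz: "q \<noteq> 0" "r \<noteq> 0"
    and pq: "0 \<le> cross p q" and qr: "0 \<le> cross q r" and qs: "0 \<le> cross q s" and rs: "0 \<le> cross r s"
  shows "cross p q + cross q r + cross r s \<le> 2 * area S"
proof -
  define n :: "real^2 \<Rightarrow> real^2" where "n z = vector [- z $ 2, z $ 1]" for z
  have n: "n z \<bullet> x = cross z x" for z x
    by (simp add: n_def inner_plane cross_def)
  have n0: "n z \<noteq> 0" if "z \<noteq> 0" for z
    using that by (auto simp: n_def vec_eq_iff forall_2)
  have self [simp]: "cross z z = 0" for z by (simp add: cross_def)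
  have anti: "cross x z = - cross z x" for x z by (simp add: cross_def)
  let ?T = "\<lambda>p q. convex hull {0, p, q}"
  note half = triangle_halfplane[of "n _", unfolded n] triangle_halfplane[of "- n _", unfolded inner_minus_left n, simplified]
  have sub: "?T p q \<subseteq> S" "?T q r \<subseteq> S" "?T r s \<subseteq> S"
    using S by (intro hull_minimal; simp)+
  have "area (?T q r) + area (?T r s) \<le> area (?T q r \<union> ?T r s)"
  proof (rule measure_separated_le[where a = "n r"])
    show "n r \<bullet> x \<le> 0" if "x \<in> ?T q r" for x
      using half(1)[OF _ _ that, of r] qr anti[of r q] by (simp add: n)
    show "0 \<le> n r \<bullet> x" if "x \<in> ?T r s" for x
      using half(2)[OF _ _ that, of r] rs by (simp add: n)
  qed (use n0 nz lmeasurable_triangle in auto)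
  moreover have "area (?T p q) + area (?T q r \<union> ?T r s) \<le> area S"
  proof (rule measure_separated_le[where a = "n q"])
    show "n q \<bullet> x \<le> 0" if "x \<in> ?T p q" for x
      using half(1)[OF _ _ that, of q] pq anti[of q p] by (simp add: n)
    show "0 \<le> n q \<bullet> x" if "x \<in> ?T q r \<union> ?T r s" for x
      using half(2)[of q q r x] half(2)[of q r s x] qr qs that by (auto simp: n)
  qed (use n0 nz lmeasurable_triangle S sub in auto)
  ultimately show ?thesis
    using pq qr rs by (simp add: area_triangle)
qed


section \<open>Polar bodies\<close>

lemma symmetric_about_0: "symmetric_about 0 S \<longleftrightarrow> (\<forall>y\<in>S. - y \<in> S)"
  by (simp add: symmetric_about_def)

lemma polar_bodyD: "\<lbrakk>x \<in> polar_body K; y \<in> K\<rbrakk> \<Longrightarrow> x \<bullet> y \<le> 1"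
  by (simp add: polar_body_def)

lemma polar_body_Inter: "polar_body K = (\<Inter>y\<in>K. {x. y \<bullet> x \<le> 1})"
  by (auto simp: polar_body_def inner_commute)

lemma zero_in_polar_body: "0 \<in> polar_body K"
  by (simp add: polar_body_def)

lemma convex_polar_body: "convex (polar_body K)"
  unfolding polar_body_Inter by (intro convex_INT convex_halfspace_le)

lemma symmetric_polar_body:
  assumes "symmetric_about 0 K" shows "symmetric_about 0 (polar_body K)"
  unfolding symmetric_about_0
proof
  fix x assume x: "x \<in> polar_body K"
  have "(- x) \<bullet> y \<le> 1" if "y \<in> K" for y
    using polar_bodyD[OF x, of "- y"] assms that by (simp add: symmetric_about_0)
  then show "- x \<in> polar_body K" by (simp add: polar_body_def)
qed

text \<open>If \<open>K\<close> contains the disc of radius \<open>r\<close>, testing \<open>x\<close> in the polar against the point of that disc in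
  direction \<open>x\<close> bounds \<open>norm x\<close> by \<open>1 / r\<close>.\<close>

lemma compact_polar_body:
  assumes "0 \<in> interior K" shows "compact (polar_body K)"
proof -
  obtain r where r: "0 < r" "cball 0 r \<subseteq> K"
    using assms by (auto simp: mem_interior_cball)
  have "norm x \<le> 1 / r" if "x \<in> polar_body K" for x
  proof (cases "x = 0")
    case False
    have "x \<bullet> ((r / norm x) *\<^sub>R x) \<le> 1"
      using False r by (intro polar_bodyD[OF that] subsetD[OF r(2)]) (simp add: dist_norm)
    also have "x \<bullet> ((r / norm x) *\<^sub>R x) = r * norm x"
      using False by (simp add: power2_norm_eq_inner[symmetric] power2_eq_square)
    finally show ?thesis using r by (simp add: field_simps)
  qed (use r in auto)
  then have "bounded (polar_body K)"
    by (auto simp: bounded_iff)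
  moreover have "closed (polar_body K)"
    unfolding polar_body_Inter by (intro closed_INT ballI closed_halfspace_le)
  ultimately show ?thesis by (simp add: compact_eq_bounded_closed)
qed

text \<open>The bipolar theorem: a hyperplane that separates a point from \<open>K\<close> has the origin on the side of
  \<open>K\<close>, so its normal, scaled, is a point of the polar that excludes the point from the bipolar.\<close>

lemma polar_polar_body:
  assumes "convex K" "closed K" "0 \<in> K"
  shows "polar_body (polar_body K) = K"
proof
  show "K \<subseteq> polar_body (polar_body K)"
    by (auto simp: polar_body_def inner_commute)
  show "polar_body (polar_body K) \<subseteq> K"
  proof (rule subsetI, rule ccontr)
    fix x assume x: "x \<in> polar_body (polar_body K)" and "x \<notin> K"
    then obtain a b where ab: "a \<bullet> x < b" "\<And>y. y \<in> K \<Longrightarrow> b < a \<bullet> y"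
      using separating_hyperplane_closed_point[OF assms(1,2)] by blast
    have b: "b < 0" using ab(2)[OF assms(3)] by simp
    have "(1 / b) *\<^sub>R a \<in> polar_body K"
      using ab(2) b by (force simp: polar_body_def field_simps)
    then have "x \<bullet> ((1 / b) *\<^sub>R a) \<le> 1"
      by (rule polar_bodyD[OF x])
    then show False using ab(1) b by (simp add: inner_commute field_simps)
  qed
qed

lemma polar_body_linear_image:
  fixes F :: "real^2 \<Rightarrow> real^2"
  assumes "linear F"
  shows "polar_body (F ` K) = {x. adjoint F x \<in> polar_body K}"
  using assms by (auto simp: polar_body_def adjoint_clauses adjoint_linear inner_commute)

text \<open>The polar is transformed by the inverse of the adjoint, and the two determinants cancel.\<close>

lemma volume_product_linear_image:
  fixes F :: "real^2 \<Rightarrow> real^2"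
  assumes F: "linear F" "inj F" and K: "compact K" "0 \<in> interior K"
  shows "area (F ` K) * area (polar_body (F ` K)) = area K * area (polar_body K)"
proof -
  have d: "det (matrix F) \<noteq> 0"
    using F by (simp add: det_nz_iff_inj)
  have adj: "linear (adjoint F)" by (rule adjoint_linear[OF F(1)])
  have dadj: "det (matrix (adjoint F)) = det (matrix F)"
    using F(1) by (simp add: matrix_adjoint)
  then have "surj (adjoint F)"
    using adj d by (metis det_nz_iff_inj linear_injective_imp_surjective)
  then have im: "adjoint F ` polar_body (F ` K) = polar_body K"
    by (auto simp: polar_body_linear_image[OF F(1)] surj_def image_iff)
  have "0 \<in> interior (F ` K)"
  proof -
    have "F 0 \<in> F ` interior K" using K(2) by (rule imageI)
    then show ?thesis
      using F by (simp add: linear_0 interior_injective_linear_image)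
  qed
  then have "polar_body (F ` K) \<in> lmeasurable"
    by (intro lmeasurable_compact compact_polar_body)
  then have "area (polar_body K) = \<bar>det (matrix F)\<bar> * area (polar_body (F ` K))"
    unfolding area_def im[symmetric] using adj dadj by (simp add: measure_linear_image)
  moreover have "area (F ` K) = \<bar>det (matrix F)\<bar> * area K"
    unfolding area_def using F K by (simp add: measure_linear_image lmeasurable_compact)
  ultimately show ?thesis by simp
qed

section \<open>Dual pairs in normal position\<close>

abbreviation (input) ex :: "real^2" where "ex \<equiv> vector [1, 0]"
abbreviation (input) ey :: "real^2" where "ey \<equiv> vector [0, 1]"

definition quadrant :: "(real^2) set" where
  "quadrant = {x. 0 \<le> x $ 1 \<and> 0 \<le> x $ 2}"

text \<open>The definition is symmetric in the two bodies, so that each lemma also serves with their roles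
  exchanged. The unit vectors in \<open>L\<close> say that \<open>K\<close> lies in the square of side \<open>2\<close>, and conversely;
  thus both bodies lie between this square and its polar, the cross-polytope.\<close>

definition dual_pair :: "(real^2) set \<Rightarrow> (real^2) set \<Rightarrow> bool" where
  "dual_pair K L \<longleftrightarrow> compact K \<and> convex K \<and> symmetric_about 0 K \<and>
     polar_body K = L \<and> compact L \<and> convex L \<and> symmetric_about 0 L \<and> polar_body L = K \<and>
     ex \<in> K \<and> ey \<in> K \<and> ex \<in> L \<and> ey \<in> L"

lemma dual_pair_sym: "dual_pair K L \<Longrightarrow> dual_pair L K"
  unfolding dual_pair_def by blast

lemma dual_pairD:
  assumes "dual_pair K L"
  shows "compact K" "convex K" "polar_body L = K" "ex \<in> K" "ey \<in> K" "\<And>x. x \<in> K \<Longrightarrow> - x \<in> K"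
  using assms unfolding dual_pair_def symmetric_about_0 by blast+

lemma vec2_eqI: "\<lbrakk>x $ 1 = y $ 1; x $ 2 = y $ 2\<rbrakk> \<Longrightarrow> x = y" for x y :: "real^2"
  by (simp add: vec_eq_iff forall_2)

lemma vec2_eq_0_iff: "x = 0 \<longleftrightarrow> x $ 1 = 0 \<and> x $ 2 = 0" for x :: "real^2"
  by (simp add: vec_eq_iff forall_2)

lemma mem_quadrant: "x \<in> quadrant \<longleftrightarrow> 0 \<le> x $ 1 \<and> 0 \<le> x $ 2"
  by (simp add: quadrant_def)

lemma dual_pair_le1:
  assumes "dual_pair K L" "x \<in> K"
  shows "\<bar>x $ 1\<bar> \<le> 1" "\<bar>x $ 2\<bar> \<le> 1"
proof -
  have le: "y $ 1 \<le> 1 \<and> y $ 2 \<le> 1" if "y \<in> K" for y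
  proof -
    have "y \<in> polar_body L" "ex \<in> L" "ey \<in> L"
      using that dual_pairD(3)[OF assms(1)] dual_pairD(4,5)[OF dual_pair_sym[OF assms(1)]]
      by (simp_all only:)
    from polar_bodyD[OF this(1,2)] polar_bodyD[OF this(1,3)] show ?thesis
      by (simp add: inner_plane)
  qed
  have "- x \<in> K" by (rule dual_pairD(6)[OF assms])
  with le[OF assms(2)] le[of "- x"] show "\<bar>x $ 1\<bar> \<le> 1" "\<bar>x $ 2\<bar> \<le> 1"
    by (auto simp: abs_le_iff)
qed

lemma dual_pair_zero: "dual_pair K L \<Longrightarrow> 0 \<in> K"
  using dual_pairD(3) zero_in_polar_body by blast

lemma dual_pair_memI:
  assumes "dual_pair K L" "\<And>y. y \<in> L \<Longrightarrow> x \<bullet> y \<le> 1"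
  shows "x \<in> K"
proof -
  have K: "polar_body L = K" using assms(1) unfolding dual_pair_def by blast
  have "x \<in> polar_body L" unfolding polar_body_def using assms(2) by blast
  then show ?thesis unfolding K .
qed

lemma dual_pair_quadrant:
  assumes "dual_pair K L"
  shows "K \<inter> quadrant \<in> lmeasurable" "convex (K \<inter> quadrant)" "0 \<in> K \<inter> quadrant"
    "ex \<in> K \<inter> quadrant" "ey \<in> K \<inter> quadrant"
proof -
  note c = dual_pairD(1,2,4,5)[OF assms]
  have q: "quadrant = {x. ex \<bullet> x \<ge> 0} \<inter> {x. ey \<bullet> x \<ge> 0}"
    by (auto simp: quadrant_def inner_plane)
  have "convex quadrant"
    unfolding q by (intro convex_Int convex_halfspace_ge)
  then show "convex (K \<inter> quadrant)" using c by (intro convex_Int)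
  then show "K \<inter> quadrant \<in> lmeasurable"
    using c by (intro measurable_convex) (auto simp: compact_imp_bounded bounded_Int)
  show "0 \<in> K \<inter> quadrant" using dual_pair_zero[OF assms] by (simp add: quadrant_def)
  show "ex \<in> K \<inter> quadrant" "ey \<in> K \<inter> quadrant" using c by (auto simp: quadrant_def)
qed

text \<open>A point \<open>x\<close> of the quadrant part of \<open>K\<close> spans with the two unit vectors a quadrilateral of
  area \<open>(x\<^sub>1 + x\<^sub>2) / 2\<close>; outside the quadrant one coordinate is negative and the other at most \<open>1\<close>.\<close>

lemma dual_pair_sum_le_area:
  assumes "dual_pair K L" "x \<in> K"
  shows "x $ 1 + x $ 2 \<le> 2 * area (K \<inter> quadrant)"
proof (cases "x \<in> quadrant \<and> x \<noteq> 0")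
  case True
  then have "cross ex x + cross x ey + cross ey ey \<le> 2 * area (K \<inter> quadrant)"
    using assms by (intro area_fan_le dual_pair_quadrant[OF assms(1)])
      (simp_all add: cross_def mem_quadrant vec2_eq_0_iff)
  then show ?thesis by (simp add: cross_def)
next
  case False
  have "cross ex ey + cross ey ey + cross ey ey \<le> 2 * area (K \<inter> quadrant)"
    by (intro area_fan_le dual_pair_quadrant[OF assms(1)])
      (simp_all add: cross_def vec2_eq_0_iff)
  then have "1 \<le> 2 * area (K \<inter> quadrant)" by (simp add: cross_def)
  then show ?thesis
    using False dual_pair_le1[OF assms] by (auto simp: mem_quadrant abs_le_iff not_le)
qed

text \<open>The number \<open>al\<close> is the maximum of \<open>x $ 1 + x $ 2\<close> on \<open>K\<close>. It ties the first quadrants of the two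
  bodies together: it is a lower bound for twice the area of one of them, and since the supporting
  line is dual to the point \<open>(1 / al, 1 / al)\<close> of \<open>L\<close>, its inverse bounds the area of the other.\<close>

lemma dual_pair_width:
  assumes D: "dual_pair K L"
  obtains al where "1 \<le> al" "al \<le> 2" "\<And>x. x \<in> K \<Longrightarrow> x $ 1 + x $ 2 \<le> al"
    "al \<le> 2 * area (K \<inter> quadrant)" "1 / al \<le> area (L \<inter> quadrant)" "vector [1 / al, 1 / al] \<in> L"
proof -
  have K: "compact K" "K \<noteq> {}" "ex \<in> K"
    using dual_pairD(1,4)[OF D] by auto
  have "continuous_on K (\<lambda>x. x $ 1 + x $ 2)" by (intro continuous_intros)
  from continuous_attains_sup[OF K(1,2) this]
  obtain x where x: "x \<in> K" "\<And>y. y \<in> K \<Longrightarrow> y $ 1 + y $ 2 \<le> x $ 1 + x $ 2"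
    by blast
  define al where "al = x $ 1 + x $ 2"
  have al: "1 \<le> al" "al \<le> 2" using x(2)[OF K(3)] dual_pair_le1[OF D x(1)] by (auto simp: al_def)
  have v: "vector [1 / al, 1 / al] \<in> L"
  proof (rule dual_pair_memI[OF dual_pair_sym[OF D]])
    fix y assume "y \<in> K"
    then show "vector [1 / al, 1 / al] \<bullet> y \<le> 1"
      using x(2) al by (simp add: inner_plane al_def[symmetric] field_simps)
  qed
  show thesis
  proof (rule that[OF al _ _ _ v])
    show "\<And>y. y \<in> K \<Longrightarrow> y $ 1 + y $ 2 \<le> al" using x(2) by (simp add: al_def)
    show "al \<le> 2 * area (K \<inter> quadrant)" using dual_pair_sum_le_area[OF D x(1)] by (simp add: al_def)
    show "1 / al \<le> area (L \<inter> quadrant)"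
      using dual_pair_sum_le_area[OF dual_pair_sym[OF D] v] by simp
  qed
qed

lemma quadrant_product_ge:
  assumes D: "dual_pair K L"
  shows "1 / 2 \<le> area (K \<inter> quadrant) * area (L \<inter> quadrant)"
proof -
  obtain al where al: "1 \<le> al" "al \<le> 2 * area (K \<inter> quadrant)" "1 / al \<le> area (L \<inter> quadrant)"
    using dual_pair_width[OF D] by metis
  have "(al / 2) * (1 / al) \<le> area (K \<inter> quadrant) * area (L \<inter> quadrant)"
    using al by (intro mult_mono) auto
  then show ?thesis using al by simp
qed

text \<open>The points \<open>ex\<close>, \<open>(1 / al, 1 / al)\<close>, \<open>ey\<close> and the origin span a quadrilateral of area \<open>1 / al\<close> in
  the quadrant of \<open>L\<close>. A point of \<open>L\<close> beyond its edge from \<open>ex\<close> adds a triangle, whose area grows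
  linearly with the distance from that edge. So if the quadrant has little more area than the
  quadrilateral, then no point of \<open>L\<close> is far beyond its edges; \<open>tau\<close> measures this.\<close>

lemma dual_pair_beyond_edge:
  assumes D: "dual_pair K L" and al: "1 \<le> al" "al \<le> 2" "vector [1 / al, 1 / al] \<in> L" and y: "y \<in> L"
    and tau: "tau = 2 * al * area (L \<inter> quadrant) - 1" "1 \<le> tau"
  shows "y $ 1 + (al - 1) * y $ 2 \<le> tau" "(al - 1) * y $ 1 + y $ 2 \<le> tau"
proof -
  define w :: "real^2" where "w = vector [1 / al, 1 / al]"
  have D': "dual_pair L K" by (rule dual_pair_sym[OF D])
  have w: "w \<in> L \<inter> quadrant" "w \<noteq> 0"
    using al by (auto simp: w_def quadrant_def vec2_eq_0_iff)
  have le1: "y $ 1 \<le> 1" "y $ 2 \<le> 1" using dual_pair_le1[OF D' y] by auto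
  have *: "y $ 1 + (al - 1) * y $ 2 \<le> tau \<and> (al - 1) * y $ 1 + y $ 2 \<le> tau"
  proof (cases "y \<in> quadrant \<and> y \<noteq> 0")
    case True
    then have y': "y \<in> L \<inter> quadrant" "y \<noteq> 0" "0 \<le> y $ 1" "0 \<le> y $ 2"
      using y by (auto simp: quadrant_def)
    show ?thesis
    proof (cases "y $ 2 \<le> y $ 1")
      case True
      have "cross ex y + cross y w + cross w ey \<le> 2 * area (L \<inter> quadrant)"
        using True al y' w by (intro area_fan_le dual_pair_quadrant[OF D'])
          (auto simp: cross_def w_def divide_simps)
      then have "al * (cross ex y + cross y w + cross w ey) \<le> tau + 1"
        using al by (simp add: tau(1) mult.assoc mult_left_mono)
      moreover have "al * (cross ex y + cross y w + cross w ey) = y $ 1 + (al - 1) * y $ 2 + 1"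
        using al by (simp add: cross_def w_def field_simps)
      moreover have "(2 - al) * y $ 2 \<le> (2 - al) * y $ 1"
        using True al by (intro mult_left_mono) auto
      ultimately show ?thesis by (simp add: algebra_simps)
    next
      case False
      have "cross ex w + cross w y + cross y ey \<le> 2 * area (L \<inter> quadrant)"
        using False al y' w by (intro area_fan_le dual_pair_quadrant[OF D'])
          (auto simp: cross_def w_def divide_simps)
      then have "al * (cross ex w + cross w y + cross y ey) \<le> tau + 1"
        using al by (simp add: tau(1) mult.assoc mult_left_mono)
      moreover have "al * (cross ex w + cross w y + cross y ey) = (al - 1) * y $ 1 + y $ 2 + 1"
        using al by (simp add: cross_def w_def field_simps)
      moreover have "(2 - al) * y $ 1 \<le> (2 - al) * y $ 2"
        using False al by (intro mult_left_mono) auto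
      ultimately show ?thesis by (simp add: algebra_simps)
    qed
  next
    case False
    have le: "(al - 1) * t \<le> max 0 t" for t :: real
    proof (cases "0 \<le> t")
      case True
      then show ?thesis using al mult_right_mono[of "al - 1" 1 t] by simp
    qed (use al in \<open>simp add: mult_nonneg_nonpos\<close>)
    from False have "y $ 1 \<le> 0 \<or> y $ 2 \<le> 0" by (auto simp: quadrant_def)
    then show ?thesis using le[of "y $ 1"] le[of "y $ 2"] le1 tau(2) by auto
  qed
  then show "y $ 1 + (al - 1) * y $ 2 \<le> tau" "(al - 1) * y $ 1 + y $ 2 \<le> tau" by auto
qed

text \<open>Read in the dual, the previous lemma says that \<open>(1, a) / tau\<close> and \<open>(a, 1) / tau\<close> belong to \<open>K\<close>,
  where \<open>a = al - 1\<close>. The pentagon that they span with the unit vectors and the origin has, for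
  \<open>tau = 1\<close>, an area that exceeds \<open>al / 2\<close> by \<open>a * (1 - a) / 2\<close>. As the area of the quadrant of \<open>K\<close> is
  \<open>al / 2\<close> up to a factor \<open>1 + 2 * d\<close>, the number \<open>a\<close> is close to \<open>0\<close> or to \<open>1\<close>.\<close>

lemma quadrant_stability:
  assumes D: "dual_pair K L"
    and al: "1 \<le> al" "al \<le> 2" "al \<le> 2 * area (K \<inter> quadrant)" "1 / al \<le> area (L \<inter> quadrant)"
      "vector [1 / al, 1 / al] \<in> L"
    and d: "area (K \<inter> quadrant) * area (L \<inter> quadrant) \<le> 1 / 2 + d" "0 \<le> d" "d \<le> 1 / 100"
  shows "(al - 1) * (2 - al) \<le> 10.4 * d * al"
proof -
  define a where "a = al - 1"
  define A where "A = area (K \<inter> quadrant)"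
  define B where "B = area (L \<inter> quadrant)"
  have AB: "A * B \<le> 1 / 2 + d" "al \<le> 2 * A" "1 / al \<le> B" "0 < B"
    using al d less_le_trans[of 0 "1 / al" B] by (auto simp: A_def B_def)
  define tau where "tau = 2 * al * B - 1"
  have alB: "1 \<le> al * B" using AB(3) al by (simp add: field_simps)
  have "al * B \<le> 2 * A * B" using AB by (intro mult_right_mono) auto
  then have tau: "1 \<le> tau" "tau \<le> 1 + 4 * d" using alB AB(1) by (auto simp: tau_def)
  have a: "0 \<le> a" "a \<le> 1" using al by (auto simp: a_def)
  define u :: "real^2" where "u = vector [1 / tau, a / tau]"
  define v :: "real^2" where "v = vector [a / tau, 1 / tau]"
  note edge = dual_pair_beyond_edge[OF D al(1,2,5) _ tau_def[unfolded B_def] tau(1)]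
  have "u \<bullet> y \<le> 1" if "y \<in> L" for y
  proof -
    have "u \<bullet> y = (y $ 1 + a * y $ 2) / tau" by (simp add: u_def inner_plane add_divide_distrib)
    then show ?thesis using edge(1)[OF that] tau(1) by (simp add: a_def divide_le_eq)
  qed
  then have u: "u \<in> K \<inter> quadrant" 
    using a tau by (auto simp: u_def quadrant_def intro: dual_pair_memI[OF D])
  have "v \<bullet> y \<le> 1" if "y \<in> L" for y
  proof -
    have "v \<bullet> y = (a * y $ 1 + y $ 2) / tau" by (simp add: v_def inner_plane add_divide_distrib)
    then show ?thesis using edge(2)[OF that] tau(1) by (simp add: a_def divide_le_eq)
  qed
  then have v: "v \<in> K \<inter> quadrant" 
    using a tau by (auto simp: v_def quadrant_def intro: dual_pair_memI[OF D])
  have "cross ex u + cross u v + cross v ey \<le> 2 * area (K \<inter> quadrant)"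
  proof (intro area_fan_le dual_pair_quadrant[OF D] u v)
    show "u \<noteq> 0" "v \<noteq> 0" using tau by (auto simp: u_def v_def vec2_eq_0_iff)
    have "a * a \<le> 1" using a mult_le_one by blast
    then have "a * a / (tau * tau) \<le> 1 / (tau * tau)" by (rule divide_right_mono) simp
    then show "0 \<le> cross u v" by (simp add: u_def v_def cross_def)
  qed (use a tau in \<open>auto simp: u_def v_def cross_def\<close>)
  then have "2 * a / tau + (1 - a * a) / (tau * tau) \<le> 2 * A"
    by (simp add: u_def v_def cross_def A_def diff_divide_distrib)
  then have "tau * tau * (2 * a / tau + (1 - a * a) / (tau * tau)) \<le> tau * tau * (2 * A)"
    using tau by (intro mult_left_mono) auto
  moreover have "tau * tau * (2 * a / tau + (1 - a * a) / (tau * tau)) = 2 * a * tau + (1 - a * a)"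
    using tau by (simp add: field_simps)
  moreover have "2 * a * 1 \<le> 2 * a * tau" using a tau by (intro mult_left_mono) auto
  ultimately have 1: "2 * a + 1 - a * a \<le> tau * tau * (2 * A)" by simp
  have "2 * A * 1 \<le> 2 * A * (al * B)" using alB AB al by (intro mult_left_mono) auto
  also have "\<dots> = al * (2 * (A * B))" by simp
  also have "\<dots> \<le> al * (1 + 2 * d)" using AB al by (intro mult_left_mono) auto
  finally have 2: "2 * A \<le> al * (1 + 2 * d)" by simp
  \<comment> \<open>\<open>(1 + 4 * d)\<^sup>2 * (1 + 2 * d)\<close> is at most \<open>1 + 10.4 * d\<close> for \<open>d \<le> 1 / 100\<close>\<close>
  have dd: "d * d \<le> d / 100" "d * d * d \<le> d / 10000"
  proof -
    show "d * d \<le> d / 100" using mult_left_mono[OF d(3,2)] by simp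
    then have "d * d * d \<le> d / 100 * d" using d by (intro mult_right_mono)
    then show "d * d * d \<le> d / 10000" using \<open>d * d \<le> d / 100\<close> by simp
  qed
  have "tau * tau \<le> (1 + 4 * d) * (1 + 4 * d)" using tau by (intro mult_mono) auto
  then have "tau * tau * (2 * A) \<le> (1 + 4 * d) * (1 + 4 * d) * (al * (1 + 2 * d))"
    using 2 AB al d(2) by (intro mult_mono[OF \<open>tau * tau \<le> _\<close>]) auto
  also have "\<dots> = al * (1 + 10 * d + 32 * (d * d) + 32 * (d * d * d))" by (simp add: algebra_simps)
  also have "\<dots> \<le> al * (1 + 10.4 * d)" using dd al d by (intro mult_left_mono) auto
  finally have "2 * a + 1 - a * a \<le> al * (1 + 10.4 * d)" using 1 by simp
  then show ?thesis by (simp add: a_def algebra_simps)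
qed

section \<open>Adjacent quadrants\<close>

text \<open>The reflection carries the second quadrant to the first, so that the estimates for the first
  quadrant give those for the second.\<close>

definition reflect :: "real^2 \<Rightarrow> real^2" where
  "reflect x = vector [- x $ 1, x $ 2]"

lemma reflect_nth [simp]: "reflect x $ 1 = - x $ 1" "reflect x $ 2 = x $ 2"
  by (simp_all add: reflect_def)

lemma reflect_reflect [simp]: "reflect (reflect x) = x"
  by (intro vec2_eqI) simp_all

lemma mem_reflect_image: "x \<in> reflect ` S \<longleftrightarrow> reflect x \<in> S"
  by (auto intro: image_eqI[of _ _ "reflect x"])

lemma inner_reflect: "reflect x \<bullet> y = x \<bullet> reflect y"
  by (simp add: inner_plane)

lemma linear_reflect: "linear reflect"
  by (intro linearI vec2_eqI) simp_all

lemma area_reflect: "S \<in> lmeasurable \<Longrightarrow> reflect ` S \<in> lmeasurable \<and> area (reflect ` S) = area S"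
  unfolding area_def
  by (intro conjI measure_orthogonal_image measurable_orthogonal_image)
    (simp_all add: orthogonal_transformation_def linear_reflect inner_reflect)

lemma area_uminus: 
  fixes S :: "(real^2) set"
  shows "S \<in> lmeasurable \<Longrightarrow> uminus ` S \<in> lmeasurable \<and> area (uminus ` S) = area S"
  unfolding area_def
  by (intro conjI measure_orthogonal_image measurable_orthogonal_image)
    (simp_all add: orthogonal_transformation_def linear_uminus)

lemma polar_body_reflect: "polar_body (reflect ` K) = reflect ` polar_body K"
  by (intro set_eqI) (simp add: mem_reflect_image polar_body_def inner_reflect)

lemma dual_pair_reflect:
  assumes D: "dual_pair K L" shows "dual_pair (reflect ` K) (reflect ` L)"
proof -
  have half: "compact (reflect ` S)" "convex (reflect ` S)" "symmetric_about 0 (reflect ` S)"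
     "polar_body (reflect ` T) = reflect ` S" "ex \<in> reflect ` S" "ey \<in> reflect ` S"
    if S: "dual_pair S T" for S T
  proof -
    note d = dual_pairD[OF S]
    show "compact (reflect ` S)"
      by (rule compact_continuous_image[OF linear_continuous_on d(1)])
        (simp add: linear_reflect flip: linear_conv_bounded_linear)
    show "convex (reflect ` S)"
      using d(2) linear_reflect by (intro convex_linear_image)
    show "symmetric_about 0 (reflect ` S)"
      unfolding symmetric_about_0 mem_reflect_image
      using d(6) by (simp add: linear_neg[OF linear_reflect])
    show "polar_body (reflect ` T) = reflect ` S"
      unfolding polar_body_reflect d(3) ..
    have "reflect (- ex) = ex" "reflect ey = ey" by (intro vec2_eqI; simp)+
    then show "ex \<in> reflect ` S" "ey \<in> reflect ` S"
      using imageI[OF d(6)[OF d(4)], of reflect] imageI[OF d(5), of reflect] by simp_all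
  qed
  show ?thesis
    unfolding dual_pair_def using half[OF D] half[OF dual_pair_sym[OF D]] by blast
qed

lemma area_quadrants_le:
  assumes D: "dual_pair K L"
  shows "2 * (area (K \<inter> quadrant) + area (reflect ` K \<inter> quadrant)) \<le> area K"
proof -
  define A where "A = K \<inter> quadrant"
  define B where "B = reflect ` (reflect ` K \<inter> quadrant)"
  have A: "A \<in> lmeasurable" unfolding A_def by (rule dual_pair_quadrant[OF D])
  have B: "B \<in> lmeasurable" "area B = area (reflect ` K \<inter> quadrant)"
    unfolding B_def using area_reflect[OF dual_pair_quadrant(1)[OF dual_pair_reflect[OF D]]] by auto
  have "area A + area B \<le> area (A \<union> B)"
    by (rule measure_separated_le[where a = "- ex"])
      (use A B in \<open>auto simp: A_def B_def mem_quadrant inner_plane vec2_eq_0_iff\<close>)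
  moreover have "area (uminus ` (A \<union> B)) + area (A \<union> B) \<le> area K"
  proof (rule measure_separated_le[where a = ey])
    show "A \<union> B \<subseteq> K" by (auto simp: A_def B_def)
    then show "uminus ` (A \<union> B) \<subseteq> K" using dual_pairD(6)[OF D] by blast
    show "K \<in> lmeasurable" using dual_pairD(1)[OF D] by (rule lmeasurable_compact)
    show "uminus ` (A \<union> B) \<in> lmeasurable" using area_uminus[of "A \<union> B"] A B by auto
  qed (use A B in \<open>auto simp: A_def B_def mem_quadrant inner_plane vec2_eq_0_iff\<close>)
  ultimately show ?thesis
    using area_uminus[of "A \<union> B"] A B by (simp add: A_def fmeasurable.Un)
qed

text \<open>The Cauchy-Schwarz inequality; it lets areas of adjacent quadrants be multiplied quadrant by
  quadrant although they differ.\<close>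

lemma sum_product_ge:
  fixes a1 a2 b1 b2 :: real
  assumes "0 \<le> a1" "0 \<le> a2" "0 \<le> b1" "0 \<le> b2"
  shows "(sqrt (a1 * b1) + sqrt (a2 * b2))\<^sup>2 \<le> (a1 + a2) * (b1 + b2)"
proof -
  have "0 \<le> (sqrt (a1 * b2) - sqrt (a2 * b1))\<^sup>2" by simp
  then have "2 * (sqrt (a1 * b2) * sqrt (a2 * b1)) \<le> a1 * b2 + a2 * b1"
    using assms by (simp add: power2_diff)
  moreover have "sqrt (a1 * b2) * sqrt (a2 * b1) = sqrt (a1 * b1) * sqrt (a2 * b2)"
    by (simp add: real_sqrt_mult)
  ultimately show ?thesis
    using assms by (simp add: power2_sum algebra_simps)
qed

text \<open>Both quadrant products are at least \<open>1 / 2\<close> and their square roots have a sum of at most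
  \<open>sqrt (2 * (1 + e))\<close>, so neither can be much larger than \<open>1 / 2\<close>.\<close>

lemma product_le_of_sum_product:
  fixes a1 a2 b1 b2 e :: real
  assumes "0 \<le> a1" "0 \<le> a2" "0 \<le> b1" "0 \<le> b2" "0 \<le> e"
    and "1 / 2 \<le> a2 * b2" "(a1 + a2) * (b1 + b2) \<le> 2 * (1 + e)"
  shows "a1 * b1 \<le> (1 + e)\<^sup>2 / 2"
proof -
  define c :: real where "c = sqrt (1 / 2)"
  have c: "0 \<le> c" "c\<^sup>2 = 1 / 2" by (simp_all add: c_def)
  have "c \<le> sqrt (a2 * b2)" unfolding c_def using assms by (intro real_sqrt_le_mono)
  moreover have "sqrt (a1 * b1) + sqrt (a2 * b2) \<le> c * (2 + e)"
  proof (rule power2_le_imp_le)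
    have "(c * (2 + e))\<^sup>2 = 2 * (1 + e) + e\<^sup>2 / 2"
      unfolding power_mult_distrib c(2) by (simp add: power2_eq_square field_simps)
    then show "(sqrt (a1 * b1) + sqrt (a2 * b2))\<^sup>2 \<le> (c * (2 + e))\<^sup>2"
      using sum_product_ge[of a1 a2 b1 b2] assms zero_le_power2[of e] by linarith
  qed (use c assms in auto)
  ultimately have "sqrt (a1 * b1) \<le> c * (1 + e)" by (simp add: algebra_simps)
  then have "(sqrt (a1 * b1))\<^sup>2 \<le> (c * (1 + e))\<^sup>2" using assms by (intro power_mono) auto
  then show ?thesis using assms by (simp add: power_mult_distrib c)
qed

text \<open>Mahler's inequality in the plane: each quadrant contributes a product of at least \<open>1 / 2\<close>, and
  each body has twice the area of its two upper quadrants.\<close>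

lemma dual_pair_mahler:
  assumes D: "dual_pair K L"
  shows "8 \<le> area K * area L"
proof -
  define A1 where "A1 = area (K \<inter> quadrant)"
  define B1 where "B1 = area (L \<inter> quadrant)"
  define A2 where "A2 = area (reflect ` K \<inter> quadrant)"
  define B2 where "B2 = area (reflect ` L \<inter> quadrant)"
  have nn: "0 \<le> A1" "0 \<le> A2" "0 \<le> B1" "0 \<le> B2"
    by (simp_all add: A1_def A2_def B1_def B2_def area_def)
  have p: "1 / 2 \<le> A1 * B1" "1 / 2 \<le> A2 * B2"
    using quadrant_product_ge[OF D] quadrant_product_ge[OF dual_pair_reflect[OF D]]
    by (simp_all add: A1_def A2_def B1_def B2_def)
  have "8 = 4 * (sqrt (1 / 2) + sqrt (1 / 2))\<^sup>2" by (simp add: power2_eq_square field_simps)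
  also have "\<dots> \<le> 4 * (sqrt (A1 * B1) + sqrt (A2 * B2))\<^sup>2"
    using p by (intro mult_left_mono power_mono add_mono real_sqrt_le_mono) auto
  also have "\<dots> \<le> 4 * ((A1 + A2) * (B1 + B2))"
    using sum_product_ge[OF nn] by simp
  also have "\<dots> = (2 * (A1 + A2)) * (2 * (B1 + B2))" by (simp add: algebra_simps)
  also have "\<dots> \<le> area K * area L"
    using area_quadrants_le[OF D] area_quadrants_le[OF dual_pair_sym[OF D]] nn
    by (intro mult_mono) (auto simp: A1_def A2_def B1_def B2_def area_def)
  finally show ?thesis .
qed

text \<open>The two alternatives of \<open>quadrant_stability\<close>: in the quadrant, either \<open>K\<close> nearly is the triangle
  with vertices \<open>0\<close>, \<open>ex\<close>, \<open>ey\<close>, or \<open>K\<close> nearly is the unit square, and then \<open>L\<close> is nearly the triangle.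
  The area bounds serve to show that adjacent quadrants choose the same alternative.\<close>

lemma dual_pair_width_dichotomy:
  assumes D: "dual_pair K L" and e: "0 < e" "e \<le> 1 / 200"
    and p: "area (K \<inter> quadrant) * area (L \<inter> quadrant) \<le> (1 + e)\<^sup>2 / 2"
  shows "(\<forall>x\<in>K. x $ 1 + x $ 2 \<le> 1 + 31.3 * e) \<and> 1 / (1 + 31.3 * e) \<le> area (L \<inter> quadrant) \<or>
    (\<forall>y\<in>L. y $ 1 + y $ 2 \<le> 1 + 20 * e) \<and> 1 - 15.65 * e \<le> area (K \<inter> quadrant)"
proof -
  obtain al where al: "1 \<le> al" "al \<le> 2" "\<And>x. x \<in> K \<Longrightarrow> x $ 1 + x $ 2 \<le> al"
    "al \<le> 2 * area (K \<inter> quadrant)" "1 / al \<le> area (L \<inter> quadrant)" "vector [1 / al, 1 / al] \<in> L"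
    using dual_pair_width[OF D] by metis
  define d where "d = e + e\<^sup>2 / 2"
  have ee: "e\<^sup>2 \<le> e / 200"
    using mult_left_mono[OF e(2) less_imp_le[OF e(1)]] by (simp add: power2_eq_square)
  then have d: "0 \<le> d" "d \<le> 401 / 400 * e" using e by (simp_all add: d_def)
  have pd: "area (K \<inter> quadrant) * area (L \<inter> quadrant) \<le> 1 / 2 + d"
    using p by (simp add: d_def power2_eq_square algebra_simps)
  \<comment> \<open>the larger of the two factors is at least \<open>al / 3\<close> in both cases below, so the smaller one is at most
    \<open>3 * 10.4 * d\<close>, which is less than \<open>31.3 * e\<close>\<close>
  have q: "(al - 1) * (2 - al) \<le> 10.4 * d * al"
    using d e by (intro quadrant_stability[OF D al(1,2,4,5,6) pd]) auto
  show ?thesis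
  proof (cases "al \<le> 3 / 2")
    case True
    have "(al - 1) * (1 / 2) \<le> (al - 1) * (2 - al)" using True al by (intro mult_left_mono) auto
    also note q
    also have "10.4 * d * al \<le> 10.4 * d * (3 / 2)" using True d by (intro mult_left_mono) auto
    finally have le: "al \<le> 1 + 31.3 * e" using d e by simp
    then have "1 / (1 + 31.3 * e) \<le> 1 / al" using al by (intro divide_left_mono) auto
    then show ?thesis using le al(3,5) by force
  next
    case False
    have "10.4 * d * al \<le> 10.4 * d * (3 * (al - 1))" using False d by (intro mult_left_mono) auto
    then have "(al - 1) * (2 - al) \<le> (al - 1) * (31.2 * d)" using q by (simp add: algebra_simps)
    then have "2 - al \<le> 31.2 * d" using False by (simp only: mult_le_cancel_left_pos)
    then have A: "1 - 15.65 * e \<le> area (K \<inter> quadrant)" using al(4) d e by simp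
    have "2 * area (L \<inter> quadrant) \<le> 1 + 20 * e"
    proof (rule ccontr)
      assume "\<not> ?thesis"
      then have "(1 - 15.65 * e) * (1 + 20 * e) \<le> area (K \<inter> quadrant) * (2 * area (L \<inter> quadrant))"
        using A e by (intro mult_mono) auto
      also have "\<dots> \<le> 1 + 2 * d" using pd by simp
      finally have "1 + 4.35 * e - 313 * e\<^sup>2 \<le> 1 + 2 * d"
        by (simp add: power2_eq_square field_simps)
      then show False using ee d e by simp
    qed
    then show ?thesis
      using A dual_pair_sum_le_area[OF dual_pair_sym[OF D]] by force
  qed
qed

lemma dual_pair_contains_cross_polytope:
  assumes D: "dual_pair K L" and x: "\<bar>x $ 1\<bar> + \<bar>x $ 2\<bar> \<le> 1"
  shows "x \<in> K"
proof (rule dual_pair_memI[OF D])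
  fix y assume y: "y \<in> L"
  have "x \<bullet> y \<le> \<bar>x $ 1\<bar> * \<bar>y $ 1\<bar> + \<bar>x $ 2\<bar> * \<bar>y $ 2\<bar>"
    unfolding inner_plane by (intro add_mono) (simp_all flip: abs_mult)
  also have "\<dots> \<le> \<bar>x $ 1\<bar> * 1 + \<bar>x $ 2\<bar> * 1"
    using dual_pair_le1[OF dual_pair_sym[OF D] y] by (intro add_mono mult_left_mono) auto
  finally show "x \<bullet> y \<le> 1" using x by simp
qed

lemma dual_pair_l1_le:
  assumes D: "dual_pair K L" and "\<And>x. x \<in> K \<Longrightarrow> x $ 1 + x $ 2 \<le> r"
    and "\<And>x. x \<in> reflect ` K \<Longrightarrow> x $ 1 + x $ 2 \<le> r" and x: "x \<in> K"
  shows "\<bar>x $ 1\<bar> + \<bar>x $ 2\<bar> \<le> r"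
proof -
  have "- x \<in> K" by (rule dual_pairD(6)[OF D x])
  then have "reflect x \<in> reflect ` K" "reflect (- x) \<in> reflect ` K" using x by blast+
  from assms(3)[OF this(1)] assms(3)[OF this(2)] assms(2)[OF x] assms(2)[OF \<open>- x \<in> K\<close>] show ?thesis
    by (auto simp: abs_if)
qed

text \<open>Both parallelograms are centred at the origin and spanned by the same vectors; \<open>r\<close> is the ratio
  of their sizes.\<close>

definition between_parallelograms :: "real \<Rightarrow> (real^2) set \<Rightarrow> bool" where
  "between_parallelograms r K \<longleftrightarrow> (\<exists>p q. cross p q \<noteq> 0 \<and>
     (\<forall>s t. \<bar>s\<bar> \<le> 1 \<longrightarrow> \<bar>t\<bar> \<le> 1 \<longrightarrow> s *\<^sub>R p + t *\<^sub>R q \<in> K) \<and>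
     (\<forall>x\<in>K. \<exists>s t. \<bar>s\<bar> \<le> r \<and> \<bar>t\<bar> \<le> r \<and> x = s *\<^sub>R p + t *\<^sub>R q))"

lemma dual_pair_between_l1:
  assumes D: "dual_pair K L" and r: "\<And>x. x \<in> K \<Longrightarrow> \<bar>x $ 1\<bar> + \<bar>x $ 2\<bar> \<le> r"
  shows "between_parallelograms r K"
  unfolding between_parallelograms_def
proof (intro exI conjI allI impI ballI)
  let ?p = "vector [1 / 2, 1 / 2] :: real^2" and ?q = "vector [1 / 2, - 1 / 2] :: real^2"
  show "cross ?p ?q \<noteq> 0" by (simp add: cross_def)
  show "s *\<^sub>R ?p + t *\<^sub>R ?q \<in> K" if "\<bar>s\<bar> \<le> 1" "\<bar>t\<bar> \<le> 1" for s t
    using that by (intro dual_pair_contains_cross_polytope[OF D]) (simp add: abs_if, auto split: if_splits)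
  fix x assume "x \<in> K"
  then show "\<bar>x $ 1 + x $ 2\<bar> \<le> r" "\<bar>x $ 1 - x $ 2\<bar> \<le> r" using r by force+
  show "x = (x $ 1 + x $ 2) *\<^sub>R ?p + (x $ 1 - x $ 2) *\<^sub>R ?q"
    by (intro vec2_eqI) (simp_all add: field_simps)
qed

lemma dual_pair_between_max:
  assumes D: "dual_pair K L" and r: "0 < r" "\<And>y. y \<in> L \<Longrightarrow> \<bar>y $ 1\<bar> + \<bar>y $ 2\<bar> \<le> r"
  shows "between_parallelograms r K"
  unfolding between_parallelograms_def
proof (intro exI conjI allI impI ballI)
  let ?p = "vector [1 / r, 0] :: real^2" and ?q = "vector [0, 1 / r] :: real^2"
  show "cross ?p ?q \<noteq> 0" using r by (simp add: cross_def)
  show "s *\<^sub>R ?p + t *\<^sub>R ?q \<in> K" if st: "\<bar>s\<bar> \<le> 1" "\<bar>t\<bar> \<le> 1" for s t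
  proof (rule dual_pair_memI[OF D])
    fix y assume y: "y \<in> L"
    have "s * y $ 1 + t * y $ 2 \<le> \<bar>s\<bar> * \<bar>y $ 1\<bar> + \<bar>t\<bar> * \<bar>y $ 2\<bar>"
      by (intro add_mono) (simp_all flip: abs_mult)
    also have "\<dots> \<le> 1 * \<bar>y $ 1\<bar> + 1 * \<bar>y $ 2\<bar>" using st by (intro add_mono mult_right_mono) auto
    finally have "s * y $ 1 + t * y $ 2 \<le> r" using r(2)[OF y] by simp
    then show "(s *\<^sub>R ?p + t *\<^sub>R ?q) \<bullet> y \<le> 1" using r(1) by (simp add: inner_plane field_simps)
  qed
  fix x assume "x \<in> K"
  then show "\<bar>r * x $ 1\<bar> \<le> r" "\<bar>r * x $ 2\<bar> \<le> r"
    using dual_pair_le1[OF D] r(1) by (auto simp: abs_mult)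
  show "x = (r * x $ 1) *\<^sub>R ?p + (r * x $ 2) *\<^sub>R ?q"
    using r(1) by (intro vec2_eqI) simp_all
qed

text \<open>Adjacent quadrants cannot choose different alternatives of \<open>dual_pair_width_dichotomy\<close>: then one
  mixed product of areas would be close to \<open>1\<close>, hence the other one, as their product is at least
  \<open>1 / 4\<close>, at least about \<open>1 / 4\<close>. But the other two products are at least \<open>1 / 2\<close> each, and the assumed
  bound on the sum of all four leaves only about \<open>1\<close> for the mixed ones.
  So \<open>K\<close> is near the cross-polytope or near the square, and both are parallelograms. For large
  \<open>e\<close> the ratio \<open>2\<close> between the square and the cross-polytope is already good enough.\<close>

lemma dual_pair_stability:
  assumes D: "dual_pair K L" and e: "0 < e" and vp: "area K * area L \<le> (1 + e) * 8"
  shows "\<exists>r. 0 < r \<and> r \<le> 1 + 200 * e \<and> between_parallelograms r K"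
proof (cases "e \<le> 1 / 200")
  case False
  have "between_parallelograms 2 K"
    using dual_pair_le1[OF D] by (intro dual_pair_between_l1[OF D]) force
  then show ?thesis using False by (intro exI[of _ 2]) auto
next
  case True
  note e = e True
  define A1 where "A1 = area (K \<inter> quadrant)"
  define B1 where "B1 = area (L \<inter> quadrant)"
  define A2 where "A2 = area (reflect ` K \<inter> quadrant)"
  define B2 where "B2 = area (reflect ` L \<inter> quadrant)"
  have nn: "0 \<le> A1" "0 \<le> A2" "0 \<le> B1" "0 \<le> B2"
    by (simp_all add: A1_def A2_def B1_def B2_def area_def)
  note D' = dual_pair_reflect[OF D]
  have p: "1 / 2 \<le> A1 * B1" "1 / 2 \<le> A2 * B2"
    using quadrant_product_ge[OF D] quadrant_product_ge[OF D']
    by (simp_all add: A1_def A2_def B1_def B2_def)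
  have "(2 * (A1 + A2)) * (2 * (B1 + B2)) \<le> area K * area L"
    using area_quadrants_le[OF D] area_quadrants_le[OF dual_pair_sym[OF D]] nn
    by (intro mult_mono) (auto simp: A1_def A2_def B1_def B2_def area_def)
  moreover have "(2 * (A1 + A2)) * (2 * (B1 + B2)) = 4 * ((A1 + A2) * (B1 + B2))"
    by (simp add: algebra_simps)
  ultimately have s: "(A1 + A2) * (B1 + B2) \<le> 2 * (1 + e)" using vp by linarith
  have u: "A1 * B1 \<le> (1 + e)\<^sup>2 / 2" "A2 * B2 \<le> (1 + e)\<^sup>2 / 2"
    using product_le_of_sum_product[OF nn less_imp_le[OF e(1)] p(2) s]
      product_le_of_sum_product[OF nn(2,1,4,3) less_imp_le[OF e(1)] p(1)] s by (simp_all add: add.commute)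
  \<comment> \<open>\<open>a * b\<close> and \<open>Y\<close> stand for the two mixed products of areas\<close>
  have mixed: False if "1 / (1 + 31.3 * e) \<le> b" "1 - 15.65 * e \<le> a" "a * b + Y \<le> 1 + 2 * e"
     "1 / 4 \<le> (a * b) * Y" "0 \<le> Y" for a b Y
  proof -
    \<comment> \<open>\<open>1.1565\<close> is \<open>1 + 31.3 * e\<close> for the largest \<open>e\<close>, namely \<open>1 / 200\<close>\<close>
    have "1 / 1.1565 \<le> 1 / (1 + 31.3 * e)" using e by (intro divide_left_mono) auto
    then have "0.86 \<le> b" using that(1) by simp
    moreover have "0.92 \<le> a" using that(2) e by simp
    ultimately have "0.92 * 0.86 \<le> a * b" by (intro mult_mono) auto
    then have X: "0.79 \<le> a * b" "a * b \<le> 1.01" "Y \<le> 0.22" using that e by auto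
    have "(a * b) * Y \<le> 1.01 * 0.22" using X that(5) by (intro mult_mono) auto
    then show False using that by simp
  qed
  have "A2 * B1 + A1 * B2 \<le> 1 + 2 * e" using s p by (simp add: algebra_simps)
  moreover have "1 / 4 \<le> (A2 * B1) * (A1 * B2)"
    using mult_mono[OF p] nn by (simp add: mult_ac)
  ultimately have m: "\<not> (1 / (1 + 31.3 * e) \<le> B1 \<and> 1 - 15.65 * e \<le> A2)"
      "\<not> (1 / (1 + 31.3 * e) \<le> B2 \<and> 1 - 15.65 * e \<le> A1)"
    using mixed[of B1 A2 "A1 * B2"] mixed[of B2 A1 "A2 * B1"] nn by (auto simp: mult_ac add_ac)
  from dual_pair_width_dichotomy[OF D e u(1)[unfolded A1_def B1_def]]
    dual_pair_width_dichotomy[OF D' e u(2)[unfolded A2_def B2_def]] m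
  consider "\<forall>x\<in>K. x $ 1 + x $ 2 \<le> 1 + 31.3 * e" "\<forall>x\<in>reflect ` K. x $ 1 + x $ 2 \<le> 1 + 31.3 * e"
    | "\<forall>y\<in>L. y $ 1 + y $ 2 \<le> 1 + 20 * e" "\<forall>y\<in>reflect ` L. y $ 1 + y $ 2 \<le> 1 + 20 * e"
    unfolding A1_def B1_def A2_def B2_def by meson
  then show ?thesis
  proof cases
    case 1
    then have "between_parallelograms (1 + 31.3 * e) K"
      by (intro dual_pair_between_l1[OF D] dual_pair_l1_le[OF D]) auto
    then show ?thesis using e by (intro exI[of _ "1 + 31.3 * e"]) auto
  next
    case 2
    then have "between_parallelograms (1 + 20 * e) K"
      using e by (intro dual_pair_between_max[OF D] dual_pair_l1_le[OF dual_pair_sym[OF D]]) auto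
    then show ?thesis using e by (intro exI[of _ "1 + 20 * e"]) auto
  qed
qed

section \<open>Linear coordinates\<close>

definition frame :: "real^2 \<Rightarrow> real^2 \<Rightarrow> real^2 \<Rightarrow> real^2" where
  "frame p q y = y $ 1 *\<^sub>R p + y $ 2 *\<^sub>R q"

definition coords :: "real^2 \<Rightarrow> real^2 \<Rightarrow> real^2 \<Rightarrow> real^2" where
  "coords p q x = vector [cross x q / cross p q, cross p x / cross p q]"

lemma linear_frame: "linear (frame p q)"
  by (rule linearI) (simp_all add: frame_def algebra_simps)

lemma linear_coords: "linear (coords p q)"
  by (rule linearI) (auto intro!: vec2_eqI simp: coords_def cross_def field_simps simp flip: add_divide_distrib)

lemma frame_coords: "cross p q \<noteq> 0 \<Longrightarrow> frame p q (coords p q x) = x"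
  by (rule vec2_eqI) (simp_all add: frame_def coords_def field_simps, simp_all add: cross_def algebra_simps)

lemma coords_frame: "cross p q \<noteq> 0 \<Longrightarrow> coords p q (frame p q y) = y"
  by (rule vec2_eqI) (simp_all add: frame_def coords_def field_simps, simp_all add: cross_def algebra_simps)

lemma cross_frame: "cross (frame u v p) (frame u v q) = cross u v * cross p q"
  by (simp add: cross_def frame_def algebra_simps)

lemma inj_frame: "cross p q \<noteq> 0 \<Longrightarrow> inj (frame p q)"
  by (rule inj_on_inverseI) (rule coords_frame)

lemma continuous_on_linear: "linear f \<Longrightarrow> continuous_on S f" for f :: "real^2 \<Rightarrow> real^2"
  by (intro linear_continuous_on) (simp flip: linear_conv_bounded_linear)

lemma preimage_frame_eq: "cross p q \<noteq> 0 \<Longrightarrow> coords p q ` K = {y. frame p q y \<in> K}"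
  by (auto simp: frame_coords image_iff) (metis coords_frame)

lemma image_frame_coords: "cross p q \<noteq> 0 \<Longrightarrow> frame p q ` coords p q ` K = K"
  by (simp add: image_image frame_coords)

lemma convex_body_coords:
  assumes "cross p q \<noteq> 0" "convex_body K" shows "convex_body (coords p q ` K)"
proof -
  have "inj (coords p q)" by (rule inj_on_inverseI) (rule frame_coords[OF assms(1)])
  then show ?thesis
    using assms(2) interior_injective_linear_image[OF linear_coords, of p q K]
    by (auto simp: convex_body_def intro!: compact_continuous_image continuous_on_linear
      linear_coords convex_linear_image)
qed

lemma interior_coords:
  assumes "cross p q \<noteq> 0" "0 \<in> interior K" shows "0 \<in> interior (coords p q ` K)"
proof -
  have "inj (coords p q)" by (rule inj_on_inverseI) (rule frame_coords[OF assms(1)])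
  then have "interior (coords p q ` K) = coords p q ` interior K"
    by (rule interior_injective_linear_image[OF linear_coords])
  then show ?thesis
    using imageI[OF assms(2), of "coords p q"] by (simp add: linear_0 linear_coords)
qed

lemma symmetric_about_coords:
  assumes "symmetric_about c K" shows "symmetric_about (coords p q c) (coords p q ` K)"
  using assms unfolding symmetric_about_def
  by (auto simp: linear_diff[OF linear_coords, symmetric] linear_scale[OF linear_coords, symmetric])

lemma volume_product_coords:
  assumes "cross p q \<noteq> 0" "convex_body K" "0 \<in> interior K"
  shows "area (coords p q ` K) * area (polar_body (coords p q ` K)) = area K * area (polar_body K)"
  using volume_product_linear_image[OF linear_frame inj_frame[OF assms(1)] _ interior_coords[OF assms(1,3)]]
    convex_body_coords[OF assms(1,2)]
  by (simp add: convex_body_def image_frame_coords[OF assms(1)])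


section \<open>Bodies symmetric about the origin\<close>

text \<open>The origin is the midpoint of two opposite discs in \<open>K\<close>.\<close>

lemma symmetric_interior:
  assumes "convex_body K" "symmetric_about 0 K" shows "0 \<in> interior K"
proof -
  obtain a r where r: "0 < r" "ball a r \<subseteq> K"
    using assms(1) unfolding convex_body_def by (meson ex_in_conv mem_interior)
  have "ball 0 r \<subseteq> K"
  proof
    fix x :: "real^2" assume "x \<in> ball 0 r"
    then have "a + x \<in> K" "a - x \<in> K" using r(2) by (auto simp: subset_iff dist_norm)
    then have "a + x \<in> K" "- (a - x) \<in> K" using assms(2) by (auto simp: symmetric_about_0)
    then have "(1 / 2) *\<^sub>R (a + x) + (1 / 2) *\<^sub>R (- (a - x)) \<in> K"
      using assms(1) by (intro convexD) (auto simp: convex_body_def)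
    also have "(1 / 2) *\<^sub>R (a + x) + (1 / 2) *\<^sub>R (- (a - x)) = x"
      by (rule vec2_eqI) (simp_all add: field_simps)
    finally show "x \<in> K" .
  qed
  then show ?thesis using r(1) by (auto simp: mem_interior)
qed

text \<open>Take an inscribed parallelogram with vertices \<open>u\<close>, \<open>v\<close>, \<open>-u\<close>, \<open>-v\<close> of maximal area.
  By maximality, the line through \<open>u\<close> parallel to \<open>v\<close> supports \<open>K\<close>, and likewise at \<open>v\<close>; in the coordinates given by \<open>u\<close> and \<open>v\<close>,
  this places \<open>K\<close> in the square of side \<open>2\<close>.\<close>

lemma normal_position:
  assumes K: "convex_body K" "symmetric_about 0 K"
  obtains u v where "cross u v \<noteq> 0" "dual_pair (coords u v ` K) (polar_body (coords u v ` K))"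
proof -
  have cK: "compact K" "convex K" using K(1) by (auto simp: convex_body_def)
  obtain r where r: "0 < r" "cball 0 r \<subseteq> K"
    using symmetric_interior[OF K] by (auto simp: mem_interior_cball)
  have rK: "r *\<^sub>R ex \<in> K" "r *\<^sub>R ey \<in> K"
  proof -
    have "ex = axis 1 1" "ey = axis 2 1" by (rule vec2_eqI; simp add: axis_def)+
    then show "r *\<^sub>R ex \<in> K" "r *\<^sub>R ey \<in> K" using r by (auto simp: subset_iff dist_norm)
  qed
  have "compact (K \<times> K)" "K \<times> K \<noteq> {}" "continuous_on (K \<times> K) (\<lambda>z. cross (fst z) (snd z))"
    using cK rK by (auto simp: cross_def compact_Times intro!: continuous_intros)
  from continuous_attains_sup[OF this]
  obtain u v where uv: "u \<in> K" "v \<in> K" and max: "\<And>x y. x \<in> K \<Longrightarrow> y \<in> K \<Longrightarrow> cross x y \<le> cross u v"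
    by force
  have pos: "0 < cross u v"
  proof (rule less_le_trans)
    show "0 < cross (r *\<^sub>R ex) (r *\<^sub>R ey)" using r(1) by (simp add: cross_def)
  qed (rule max[OF rK])
  define K1 where "K1 = coords u v ` K"
  have K1: "convex_body K1" "symmetric_about 0 K1" "0 \<in> interior K1"
    using convex_body_coords[OF _ K(1)] symmetric_about_coords[OF K(2), of u v]
      interior_coords[OF _ symmetric_interior[OF K]] pos
    by (auto simp: K1_def linear_0[OF linear_coords])
  have le1: "y $ 1 \<le> 1" "y $ 2 \<le> 1" if y: "y \<in> K1" for y
  proof -
    obtain x where x: "x \<in> K" "y = coords u v x" using y by (auto simp: K1_def)
    show "y $ 1 \<le> 1" "y $ 2 \<le> 1"
      using max[OF x(1) uv(2)] max[OF uv(1) x(1)] pos by (simp_all add: x(2) coords_def)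
  qed
  have "dual_pair K1 (polar_body K1)"
    unfolding dual_pair_def
  proof (intro conjI)
    show "compact K1" "convex K1" "symmetric_about 0 K1" using K1 by (auto simp: convex_body_def)
    show "compact (polar_body K1)" by (rule compact_polar_body[OF K1(3)])
    show "polar_body (polar_body K1) = K1"
      using K1 interior_subset[of K1] by (intro polar_polar_body) (auto simp: convex_body_def compact_imp_closed)
    show "symmetric_about 0 (polar_body K1)"
      by (rule symmetric_polar_body[OF K1(2)])
    have "coords u v u = ex" "coords u v v = ey"
      using pos by (auto intro!: vec2_eqI simp: coords_def cross_def)
    then show "ex \<in> K1" "ey \<in> K1"
      using imageI[OF uv(1), of "coords u v"] imageI[OF uv(2), of "coords u v"] by (simp_all add: K1_def)
    show "ex \<in> polar_body K1" "ey \<in> polar_body K1"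
      using le1 by (auto simp: polar_body_def inner_plane)
  qed (simp_all add: convex_polar_body)
  then show thesis using that[of u v] pos unfolding K1_def by simp
qed

lemma symmetric_body_mahler:
  assumes K: "convex_body K" "symmetric_about 0 K"
  shows "8 \<le> area K * area (polar_body K)"
proof -
  obtain u v where uv: "cross u v \<noteq> 0" "dual_pair (coords u v ` K) (polar_body (coords u v ` K))"
    by (rule normal_position[OF K])
  show ?thesis
    using dual_pair_mahler[OF uv(2)] volume_product_coords[OF uv(1) K(1) symmetric_interior[OF K]] by simp
qed

lemma symmetric_body_stability:
  assumes K: "convex_body K" "symmetric_about 0 K" and e: "0 < e" 
    and vp: "area K * area (polar_body K) \<le> (1 + e) * 8"
  shows "\<exists>r. 0 < r \<and> r \<le> 1 + 200 * e \<and> between_parallelograms r K"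
proof -
  obtain u v where uv: "cross u v \<noteq> 0" "dual_pair (coords u v ` K) (polar_body (coords u v ` K))"
    by (rule normal_position[OF K])
  define K1 where "K1 = coords u v ` K"
  have "\<exists>r. 0 < r \<and> r \<le> 1 + 200 * e \<and> between_parallelograms r K1"
    using dual_pair_stability[OF uv(2) e] vp volume_product_coords[OF uv(1) K(1) symmetric_interior[OF K]]
    by (simp add: K1_def)
  then obtain r p q where r: "0 < r" "r \<le> 1 + 200 * e" and pq: "cross p q \<noteq> 0"
    and lower: "\<And>s t. \<bar>s\<bar> \<le> 1 \<Longrightarrow> \<bar>t\<bar> \<le> 1 \<Longrightarrow> s *\<^sub>R p + t *\<^sub>R q \<in> K1"
    and upper: "\<And>y. y \<in> K1 \<Longrightarrow> \<exists>s t. \<bar>s\<bar> \<le> r \<and> \<bar>t\<bar> \<le> r \<and> y = s *\<^sub>R p + t *\<^sub>R q"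
    unfolding between_parallelograms_def by blast
  let ?F = "frame u v"
  have lin: "?F (s *\<^sub>R p + t *\<^sub>R q) = s *\<^sub>R ?F p + t *\<^sub>R ?F q" for s t
    by (simp add: linear_add[OF linear_frame] linear_scale[OF linear_frame])
  have "between_parallelograms r K"
    unfolding between_parallelograms_def
  proof (rule exI[of _ "?F p"], rule exI[of _ "?F q"], intro conjI allI impI ballI)
    show "cross (?F p) (?F q) \<noteq> 0" using uv(1) pq by (simp add: cross_frame)
    show "s *\<^sub>R ?F p + t *\<^sub>R ?F q \<in> K" if "\<bar>s\<bar> \<le> 1" "\<bar>t\<bar> \<le> 1" for s t
      using lower[OF that] by (simp add: K1_def preimage_frame_eq[OF uv(1)] lin)
    fix x assume "x \<in> K"
    then obtain s t where st: "\<bar>s\<bar> \<le> r" "\<bar>t\<bar> \<le> r" "coords u v x = s *\<^sub>R p + t *\<^sub>R q"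
      using upper[of "coords u v x"] unfolding K1_def by blast
    have "x = s *\<^sub>R ?F p + t *\<^sub>R ?F q"
      using arg_cong[OF st(3), of ?F] by (simp only: frame_coords[OF uv(1)] lin)
    then show "\<exists>s t. \<bar>s\<bar> \<le> r \<and> \<bar>t\<bar> \<le> r \<and> x = s *\<^sub>R ?F p + t *\<^sub>R ?F q"
      using st by blast
  qed
  then show ?thesis using r by blast
qed

section \<open>The Banach-Mazur distance\<close>

lemma parallelogram_centred:
  "parallelogram_at a u v = {frame (u /\<^sub>R 2) (v /\<^sub>R 2) y + (a + u /\<^sub>R 2 + v /\<^sub>R 2) | y. \<bar>y $ 1\<bar> \<le> 1 \<and> \<bar>y $ 2\<bar> \<le> 1}"
    (is "?P = ?C")
proof
  show "?P \<subseteq> ?C"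
  proof
    fix w assume "w \<in> ?P"
    then obtain s t where w: "w = a + s *\<^sub>R u + t *\<^sub>R v" "0 \<le> s" "s \<le> 1" "0 \<le> t" "t \<le> 1"
      by (auto simp: parallelogram_at_def)
    show "w \<in> ?C"
      using w by (intro CollectI exI[of _ "vector [2 * s - 1, 2 * t - 1]"] conjI vec2_eqI)
        (simp_all add: frame_def field_simps)
  qed
  show "?C \<subseteq> ?P"
  proof
    fix w assume "w \<in> ?C"
    then obtain y where w: "w = frame (u /\<^sub>R 2) (v /\<^sub>R 2) y + (a + u /\<^sub>R 2 + v /\<^sub>R 2)"
      "\<bar>y $ 1\<bar> \<le> 1" "\<bar>y $ 2\<bar> \<le> 1" by auto
    show "w \<in> ?P"
      unfolding parallelogram_at_def using w
      by (intro CollectI exI[of _ "(y $ 1 + 1) / 2"] exI[of _ "(y $ 2 + 1) / 2"] conjI vec2_eqI)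
        (auto simp: frame_def field_simps abs_le_iff)
  qed
qed

lemma cross_nonzero_of_independent:
  assumes "independent {u, v}" "u \<noteq> v" shows "cross u v \<noteq> 0"
proof
  assume 0: "cross u v = 0"
  have no: "a = 0 \<and> b = 0" if "a *\<^sub>R u + b *\<^sub>R v = 0" for a b
  proof -
    have "(\<Sum>x\<in>{u, v}. (if x = u then a else b) *\<^sub>R x) = 0" using assms(2) that by simp
    then have "\<forall>x\<in>{u, v}. (if x = u then a else b) = 0"
      by (rule mp[OF spec[OF conjunct2[OF assms(1)[unfolded independent_explicit]]]])
    then show ?thesis using assms(2) by auto
  qed
  have "v $ 1 *\<^sub>R u + (- u $ 1) *\<^sub>R v = 0" "v $ 2 *\<^sub>R u + (- u $ 2) *\<^sub>R v = 0"
    using 0 by (simp_all add: vec2_eq_0_iff cross_def algebra_simps)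
  from no[OF this(1)] no[OF this(2)] have "u = 0" "v = 0" by (simp_all add: vec2_eq_0_iff)
  then show False using assms(2) by simp
qed

text \<open>The affine map that takes the outer parallelogram around \<open>K\<close> to \<open>P\<close> puts \<open>K\<close> into \<open>P\<close>; blown up by
  \<open>r\<close>, the image of the inner one covers \<open>P\<close>.\<close>

lemma bm_ratio_of_between:
  assumes r: "0 < r" and b: "between_parallelograms r ((+) (- c) ` K)" and P: "parallelogram P"
  shows "r \<in> bm_ratios K P"
proof -
  define K0 where "K0 = (+) (- c) ` K"
  obtain p q where pq: "cross p q \<noteq> 0"
    and lower: "\<And>s t. \<bar>s\<bar> \<le> 1 \<Longrightarrow> \<bar>t\<bar> \<le> 1 \<Longrightarrow> s *\<^sub>R p + t *\<^sub>R q \<in> K0"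
    and upper: "\<And>y. y \<in> K0 \<Longrightarrow> \<exists>s t. \<bar>s\<bar> \<le> r \<and> \<bar>t\<bar> \<le> r \<and> y = s *\<^sub>R p + t *\<^sub>R q"
    using b unfolding between_parallelograms_def K0_def[symmetric] by blast
  obtain a u v where uv: "u \<noteq> v" "independent {u, v}" and Pat: "P = parallelogram_at a u v"
    using P unfolding parallelogram_def by blast
  define u' v' where "u' = u /\<^sub>R 2" and "v' = v /\<^sub>R 2"
  define G where "G = frame u' v'"
  define m where "m = a + u /\<^sub>R 2 + v /\<^sub>R 2"
  have Pm: "P = {G y + m | y. \<bar>y $ 1\<bar> \<le> 1 \<and> \<bar>y $ 2\<bar> \<le> 1}"
    unfolding Pat parallelogram_centred G_def m_def u'_def v'_def ..
  have cuv: "cross u' v' \<noteq> 0"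
    using cross_nonzero_of_independent[OF uv(2,1)] by (auto simp: u'_def v'_def cross_def field_simps)
  define f where "f x = (1 / r) *\<^sub>R G (coords p q x)" for x
  have G: "linear G" unfolding G_def by (rule linear_frame)
  have f: "linear f"
    unfolding f_def using linear_compose[OF linear_coords G]
    by (intro linear_compose_scale_right) (simp add: o_def)
  have "inj f"
  proof (rule inj_on_inverseI)
    show "frame p q (coords u' v' (r *\<^sub>R f x)) = x" for x
      using r by (simp add: f_def G_def coords_frame[OF cuv] frame_coords[OF pq])
  qed
  then have "bij f" by (simp add: bij_def linear_inj_imp_surj f)
  moreover have "f y + (m - f c) \<in> P" if y: "y \<in> K" for y
  proof -
    obtain s t where st: "\<bar>s\<bar> \<le> r" "\<bar>t\<bar> \<le> r" "- c + y = s *\<^sub>R p + t *\<^sub>R q"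
      using upper[OF imageI[OF y, of "(+) (- c)", folded K0_def]] by blast
    have c: "coords p q (- c + y) = vector [s, t]"
    proof -
      have "- c + y = frame p q (vector [s, t])" using st(3) by (simp add: frame_def)
      then show ?thesis by (simp only: coords_frame[OF pq])
    qed
    have "f y + (m - f c) = f (- c + y) + m" using f by (simp add: linear_diff)
    also have "\<dots> = G ((1 / r) *\<^sub>R vector [s, t]) + m"
      unfolding f_def c by (simp only: linear_scale[OF G])
    finally show ?thesis
      unfolding Pm using st r by (intro CollectI exI[of _ "(1 / r) *\<^sub>R vector [s, t]"]) auto
  qed
  moreover have "\<exists>y\<in>K. w = r *\<^sub>R f y + (m - r *\<^sub>R f c)" if w: "w \<in> P" for w
  proof -
    obtain z where z: "w = G z + m" "\<bar>z $ 1\<bar> \<le> 1" "\<bar>z $ 2\<bar> \<le> 1" using w by (auto simp: Pm)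
    from lower[OF z(2,3)] obtain y where y: "y \<in> K" "frame p q z = - c + y"
      by (auto simp: frame_def K0_def)
    have "r *\<^sub>R f (- c + y) = G z"
      unfolding f_def using r coords_frame[OF pq, of z, unfolded y(2)] by (simp only: scaleR_scaleR) simp
    then have "w = r *\<^sub>R f y + (m - r *\<^sub>R f c)"
      using f by (simp add: z(1) linear_diff algebra_simps)
    then show ?thesis using y(1) by blast
  qed
  ultimately show ?thesis unfolding bm_ratios_iff using f r by blast
qed

section \<open>Moving the origin\<close>

text \<open>With \<open>w = t\<^sup>2\<close>, the right-hand side is \<open>(2 + 6 * w) / (1 - w) ^ 3\<close>.\<close>

lemma inverse_cubes_ge:
  fixes t :: real
  assumes "\<bar>t\<bar> < 1"
  shows "2 + 12 * t\<^sup>2 \<le> (1 / (1 - t)) ^ 3 + (1 / (1 + t)) ^ 3"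
proof -
  define w where "w = t\<^sup>2"
  have w: "0 \<le> w" "w < 1" using assms by (simp_all add: w_def abs_square_less_1)
  have pos: "0 < 1 - t" "0 < 1 + t" using assms by auto
  \<comment> \<open>the quadratic factor \<open>30 - 34 * w + 12 * w\<^sup>2\<close> after completing the square\<close>
  have "0 \<le> w\<^sup>2 * (12 * (w - 17 / 12)\<^sup>2 + 71 / 12)" by simp
  also have "\<dots> = (2 + 6 * w) - (2 + 12 * w) * (1 - w) ^ 3"
    by (simp add: power2_eq_square power3_eq_cube field_simps)
  finally have "2 + 12 * w \<le> (2 + 6 * w) / (1 - w) ^ 3"
    using w by (simp add: pos_le_divide_eq)
  also have "(1 - w) ^ 3 = ((1 - t) * (1 + t)) ^ 3"
    by (simp add: w_def power2_eq_square algebra_simps)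
  also have "2 + 6 * w = (1 + t) ^ 3 + (1 - t) ^ 3"
    by (simp add: w_def power2_eq_square power3_eq_cube algebra_simps)
  also have "((1 + t) ^ 3 + (1 - t) ^ 3) / ((1 - t) * (1 + t)) ^ 3 = (1 / (1 - t)) ^ 3 + (1 / (1 + t)) ^ 3"
    using pos by (simp add: power_mult_distrib power_divide add_divide_distrib)
  finally show ?thesis by (simp add: w_def)
qed

text \<open>Moving the origin to \<open>z\<close> acts on the polar by the projective map that sends \<open>x\<close> to
  \<open>x / (1 - z \<bullet> x)\<close>, whose Jacobian determinant is \<open>(1 / (1 - z \<bullet> x)) ^ 3\<close>.\<close>

lemma polar_shift_area_integral:
  assumes L: "compact L" "L \<subseteq> polar_body K" and z: "\<And>x. x \<in> L \<Longrightarrow> z \<bullet> x < 1"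
    and M: "polar_body ((+) (- z) ` K) \<in> lmeasurable"
  shows "(\<lambda>x. (1 / (1 - z \<bullet> x)) ^ 3) integrable_on L"
    and "integral L (\<lambda>x. (1 / (1 - z \<bullet> x)) ^ 3) \<le> area (polar_body ((+) (- z) ` K))"
proof -
  define g where "g x = (1 / (1 - z \<bullet> x)) *\<^sub>R x" for x
  define g' where "g' x h = (1 / (1 - z \<bullet> x)) *\<^sub>R h + ((z \<bullet> h) / (1 - z \<bullet> x)\<^sup>2) *\<^sub>R x" for x h
  have pos: "0 < 1 - z \<bullet> x" if "x \<in> L" for x using z[OF that] by simp
  have der: "(g has_derivative g' x) (at x within L)" if "x \<in> L" for x
    unfolding g_def g'_def using pos[OF that]
    by (auto intro!: derivative_eq_intros simp: power2_eq_square fun_eq_iff divide_inverse mult_ac add_ac)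
  have inj: "inj_on g L"
  proof (rule inj_onI)
    fix x y assume xy: "x \<in> L" "y \<in> L" "g x = g y"
    have 1: "1 + z \<bullet> g w = 1 / (1 - z \<bullet> w)" if "w \<in> L" for w
      using pos[OF that] by (simp add: g_def field_simps)
    then have "1 / (1 - z \<bullet> x) = 1 / (1 - z \<bullet> y)" using xy by metis
    then show "x = y" using xy(3) pos[OF xy(1)] by (simp add: g_def)
  qed
  have det: "det (matrix (g' x)) = (1 / (1 - z \<bullet> x)) ^ 3" if "x \<in> L" for x
  proof -
    define s where "s = 1 / (1 - z \<bullet> x)"
    have s: "s * (z $ 1 * x $ 1 + z $ 2 * x $ 2) = s - 1"
      using pos[OF that] by (simp add: s_def inner_plane field_simps)
    have g's: "g' x h = s *\<^sub>R h + ((z \<bullet> h) * s\<^sup>2) *\<^sub>R x" for h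
      by (simp add: g'_def s_def power_divide)
    have "det (matrix (g' x)) = s\<^sup>2 * (1 + s * (z $ 1 * x $ 1 + z $ 2 * x $ 2))"
      by (simp add: det_2 matrix_def g's inner_plane axis_def power2_eq_square algebra_simps)
    then show ?thesis unfolding s by (simp add: s_def power3_eq_cube power2_eq_square)
  qed
  have eq: "\<bar>det (matrix (g' x))\<bar> = (1 / (1 - z \<bullet> x)) ^ 3" if "x \<in> L" for x
    unfolding det[OF that] using pos[OF that] by (simp add: abs_of_nonneg)
  have Lm: "L \<in> sets lebesgue" using L(1) lmeasurable_compact by blast
  have "continuous_on L g"
    unfolding g_def using pos by (intro continuous_intros) force
  then have gL: "g ` L \<in> lmeasurable"
    using L(1) by (intro lmeasurable_compact compact_continuous_image)
  have int: "(\<lambda>x. \<bar>det (matrix (g' x))\<bar>) integrable_on L"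
    using measurable_differentiable_image_eq[OF Lm der inj] gL by blast
  have meas: "area (g ` L) = integral L (\<lambda>x. \<bar>det (matrix (g' x))\<bar>)"
    unfolding area_def by (rule measure_differentiable_image_eq[OF Lm der inj int])
  show "(\<lambda>x. (1 / (1 - z \<bullet> x)) ^ 3) integrable_on L"
    using int by (rule integrable_eq) (rule eq)
  have "g ` L \<subseteq> polar_body ((+) (- z) ` K)"
  proof (clarsimp simp: polar_body_def)
    fix x k assume x: "x \<in> L" and k: "k \<in> K"
    have "x \<bullet> k \<le> 1" using L(2) x k by (auto simp: polar_body_def)
    then have "x \<bullet> (k - z) \<le> 1 - z \<bullet> x" by (simp add: inner_diff_right inner_commute)
    then show "g x \<bullet> (k - z) \<le> 1" using pos[OF x] by (simp add: g_def divide_le_eq)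
  qed
  then have "area (g ` L) \<le> area (polar_body ((+) (- z) ` K))"
    unfolding area_def using gL M by (intro measure_mono_fmeasurable) auto
  also have "area (g ` L) = integral L (\<lambda>x. (1 / (1 - z \<bullet> x)) ^ 3)"
    unfolding meas by (rule integral_cong) (rule eq)
  finally show "integral L (\<lambda>x. (1 / (1 - z \<bullet> x)) ^ 3) \<le> area (polar_body ((+) (- z) ` K))" .
qed

text \<open>The polars for the origins \<open>z\<close> and \<open>-z\<close> are reflections of one another, so their common area is the
  mean of two integrals over \<open>polar_body K\<close>. The mean of the integrands is at least
  \<open>1 + 6 * (z \<bullet> x)\<^sup>2\<close>. So the centre minimises the area of the polar, and the set \<open>D\<close> measures how
  fast this area grows away from the centre. For empty \<open>D\<close> this is the planar case of the
  statement that the centre of a symmetric body is its Santalo point.\<close>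

lemma area_polar_shift_ge:
  assumes K: "convex_body K" "symmetric_about 0 K" and z: "0 \<in> interior ((+) (- z) ` K)"
    and D: "D \<in> lmeasurable" "D \<subseteq> polar_body K" "\<And>x. x \<in> D \<Longrightarrow> d \<le> z \<bullet> x" and d: "0 \<le> d"
  shows "area (polar_body K) + 6 * d\<^sup>2 * area D \<le> area (polar_body ((+) (- z) ` K))"
proof -
  define L where "L = polar_body K"
  have symK: "- k \<in> K" if "k \<in> K" for k using K(2) that by (auto simp: symmetric_about_0)
  have L: "compact L" unfolding L_def by (rule compact_polar_body[OF symmetric_interior[OF K]])
  then have Lm: "L \<in> lmeasurable" by (rule lmeasurable_compact)
  have symL: "- x \<in> L" if "x \<in> L" for x
    using symmetric_polar_body[OF K(2)] that by (simp add: symmetric_about_0 L_def)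
  have lt: "z \<bullet> x < 1" if x: "x \<in> L" for x
  proof (cases "x = 0")
    case False
    obtain r where r: "0 < r" "cball 0 r \<subseteq> (+) (- z) ` K"
      using z by (auto simp: mem_interior_cball)
    have "(r / norm x) *\<^sub>R x \<in> (+) (- z) ` K"
      using r False by (intro subsetD[OF r(2)]) (simp add: dist_norm)
    then have "z + (r / norm x) *\<^sub>R x \<in> K" by (auto simp: algebra_simps)
    then have "x \<bullet> (z + (r / norm x) *\<^sub>R x) \<le> 1"
      using x unfolding L_def by (intro polar_bodyD)
    moreover have "0 < x \<bullet> ((r / norm x) *\<^sub>R x)" using False r by simp
    ultimately show ?thesis by (simp add: inner_add_right inner_commute)
  qed simp
  have lt': "(- z) \<bullet> x < 1" if "x \<in> L" for x using lt[OF symL[OF that]] by simp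
  have neg: "(+) (- (- z)) ` K = uminus ` ((+) (- z) ` K)"
  proof -
    have "(\<lambda>k. z + k) ` K = (\<lambda>k. z - k) ` K"
    proof (intro subset_antisym subsetI; clarsimp)
      show "z + k \<in> (\<lambda>k. z - k) ` K" if "k \<in> K" for k
        using symK[OF that] by (intro image_eqI[of _ _ "- k"]) auto
      show "z - k \<in> (+) z ` K" if "k \<in> K" for k
        using symK[OF that] by (intro image_eqI[of _ _ "- k"]) auto
    qed
    then show ?thesis by (simp add: image_image)
  qed
  have polneg: "polar_body (uminus ` S) = uminus ` polar_body S" for S
  proof (intro set_eqI)
    fix x
    have "x \<in> polar_body (uminus ` S) \<longleftrightarrow> - x \<in> polar_body S" by (simp add: polar_body_def)
    also have "\<dots> \<longleftrightarrow> x \<in> uminus ` polar_body S" by (auto intro: image_eqI[of _ _ "- x"])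
    finally show "x \<in> polar_body (uminus ` S) \<longleftrightarrow> x \<in> uminus ` polar_body S" .
  qed
  have M: "polar_body ((+) (- z) ` K) \<in> lmeasurable"
    by (intro lmeasurable_compact compact_polar_body z)
  have M': "polar_body ((+) (- (- z)) ` K) \<in> lmeasurable"
    "area (polar_body ((+) (- (- z)) ` K)) = area (polar_body ((+) (- z) ` K))"
    unfolding neg polneg using area_uminus[OF M] by auto
  let ?f = "\<lambda>x. (1 / (1 - z \<bullet> x)) ^ 3" and ?h = "\<lambda>x. (1 / (1 - (- z) \<bullet> x)) ^ 3"
  note f = polar_shift_area_integral[OF L _ lt M, unfolded L_def[symmetric], OF subset_refl]
  note h = polar_shift_area_integral[OF L _ lt' M'(1), unfolded L_def[symmetric], OF subset_refl]
  let ?b = "\<lambda>x. 2 + 12 * d\<^sup>2 * indicator D x :: real"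
  have LD: "L \<inter> D = D" using D(2) by (auto simp: L_def)
  have bi: "(?b has_integral 2 * area L + 12 * d\<^sup>2 * area D) L"
  proof (intro has_integral_add has_integral_mult_right)
    have "((\<lambda>x. 1) has_integral area L) L"
      unfolding area_def using Lm by (simp add: has_integral_iff lmeasure_integral lmeasurable_iff_integrable_on[symmetric])
    from has_integral_mult_right[OF this, of 2] show "((\<lambda>x. 2) has_integral 2 * area L) L" by simp
    have "((\<lambda>x. if x \<in> D then 1 else 0) has_integral area D) L"
      using D(1,2) unfolding area_def L_def[symmetric]
      by (subst has_integral_restrict) (auto simp: has_integral_iff lmeasure_integral lmeasurable_iff_integrable_on[symmetric])
    then show "(indicator D has_integral area D) L"
      by (simp add: indicator_def[abs_def] of_bool_def)
  qed
  have "integral L ?b \<le> integral L (\<lambda>x. ?f x + ?h x)"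
  proof (rule integral_le)
    show "?b integrable_on L" using bi by blast
    show "(\<lambda>x. ?f x + ?h x) integrable_on L" using f(1) h(1) by (rule integrable_add)
    fix x assume x: "x \<in> L"
    have "\<bar>z \<bullet> x\<bar> < 1" using lt[OF x] lt'[OF x] by (simp add: abs_less_iff)
    then have "2 + 12 * (z \<bullet> x)\<^sup>2 \<le> ?f x + ?h x" using inverse_cubes_ge by simp
    moreover have "d\<^sup>2 * indicator D x \<le> (z \<bullet> x)\<^sup>2"
      using D(3) d by (auto simp: indicator_def intro: power_mono)
    ultimately show "?b x \<le> ?f x + ?h x" by simp
  qed
  also have "\<dots> = integral L ?f + integral L ?h" using f(1) h(1) by (rule integral_add)
  also have "\<dots> \<le> 2 * area (polar_body ((+) (- z) ` K))"
    using f(2) h(2) M'(2) by simp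
  finally show ?thesis using integral_unique[OF bi] by (simp add: L_def)
qed

section \<open>The distance of the centre from the origin\<close>

lemma recentre:
  assumes K: "convex_body K" "symmetric_about c K"
  shows "convex_body ((+) (- c) ` K)" "symmetric_about 0 ((+) (- c) ` K)"
proof -
  have "compact ((+) (- c) ` K)" "convex ((+) (- c) ` K)" "interior ((+) (- c) ` K) \<noteq> {}"
    using K(1) unfolding convex_body_def interior_translation
    by (simp_all only: compact_translation convex_translation image_is_empty simp_thms)
  then show "convex_body ((+) (- c) ` K)" unfolding convex_body_def by blast
  show "symmetric_about 0 ((+) (- c) ` K)"
    unfolding symmetric_about_0
  proof
    fix x assume "x \<in> (+) (- c) ` K"
    then have "c + x \<in> K" by auto
    then have "2 *\<^sub>R c - (c + x) \<in> K" using K(2) unfolding symmetric_about_def by blast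
    then have "c - x \<in> K" by (simp add: scaleR_2)
    then show "- x \<in> (+) (- c) ` K" by (intro image_eqI[of _ _ "c - x"]) simp_all
  qed
qed

lemma area_box:
  assumes "0 \<le> s" "0 \<le> t"
  shows "area (cbox (vector [a, b]) (vector [a + s, b + t])) = s * t"
proof -
  let ?Q = "cbox (vector [a, b]) (vector [a + s, b + t]) :: (real^2) set"
  have "?Q \<noteq> {}" using assms by (simp add: interval_ne_empty_cart forall_2)
  moreover have "area ?Q = measure lborel ?Q"
    unfolding area_def by (rule measure_completion) simp
  ultimately show ?thesis by (simp add: content_cbox_cart UNIV_2)
qed

text \<open>In coordinates in which the two homothetic parallelograms are the squares of half-sides \<open>m1\<close> and
  \<open>m2\<close> around \<open>w1\<close> and \<open>w2\<close>, the vector \<open>w1 + w2\<close> is twice the centre in question. It lies within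
  \<open>O(e)\<close> of twice the centre \<open>c\<close> of \<open>K\<close>, because the smaller square and its reflection in \<open>c\<close> both fit
  into the larger one. The size \<open>n\<close> of \<open>c\<close> itself is \<open>O(sqrt e)\<close>: by \<open>area_polar_shift_ge\<close> the volume
  product for the origin exceeds the one for the centre, which is at least \<open>8\<close>, by a multiple of \<open>n\<^sup>2\<close>.\<close>

lemma centre_offset_bound:
  fixes w1 w2 :: "real^2"
  assumes K: "convex_body K" "symmetric_about c K" "0 \<in> interior K"
    and vp: "area K * area (polar_body K) \<le> (1 + e) * 8" and e: "0 < e" "200 * e < 1"
    and m: "m1 + m2 = 2" "0 < m1" "m2 \<le> m1 * (1 + 200 * e)"
    and lower: "\<And>y. \<bar>y $ 1\<bar> \<le> m1 \<Longrightarrow> \<bar>y $ 2\<bar> \<le> m1 \<Longrightarrow> w1 + y \<in> K"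
    and upper: "\<And>x. x \<in> K \<Longrightarrow> \<bar>x $ 1 - w2 $ 1\<bar> \<le> m2 \<and> \<bar>x $ 2 - w2 $ 2\<bar> \<le> m2"
  shows "\<bar>w1 $ 1 + w2 $ 1\<bar> + \<bar>w1 $ 2 + w2 $ 2\<bar> \<le> 1344 * sqrt e"
proof -
  have sym: "2 *\<^sub>R c - x \<in> K" if "x \<in> K" for x using K(2) that by (auto simp: symmetric_about_def)
  have m_bounds: "2 / 3 \<le> m1" "m1 \<le> 1" "m2 \<le> 4 / 3"
  proof -
    have "m1 * (1 + 200 * e) \<le> m1 * 2" using e m(2) by (intro mult_left_mono) auto
    then show "2 / 3 \<le> m1" "m2 \<le> 4 / 3" using m by linarith+
    have "w1 + vector [m1, m1] \<in> K" "w1 + vector [- m1, - m1] \<in> K" using m(2) by (auto intro!: lower)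
    from upper[OF this(1)] upper[OF this(2)] show "m1 \<le> 1" using m(1) by (auto simp: abs_le_iff)
  qed
  \<comment> \<open>opposite corners of the small square, reflected in \<open>c\<close>, lie in the large square\<close>
  have near: "\<bar>2 * c $ 1 - (w1 $ 1 + w2 $ 1)\<bar> + \<bar>2 * c $ 2 - (w1 $ 2 + w2 $ 2)\<bar> \<le> 400 * e"
  proof -
    have "w1 + vector [m1, m1] \<in> K" "w1 + vector [- m1, - m1] \<in> K" using m(2) by (auto intro!: lower)
    from upper[OF sym[OF this(1)]] upper[OF sym[OF this(2)]]
    have "\<bar>2 * c $ 1 - (w1 $ 1 + w2 $ 1)\<bar> \<le> m2 - m1 \<and> \<bar>2 * c $ 2 - (w1 $ 2 + w2 $ 2)\<bar> \<le> m2 - m1"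
      by (auto simp: abs_le_iff)
    moreover have "m1 * (200 * e) \<le> 1 * (200 * e)" using m_bounds e by (intro mult_right_mono) auto
    moreover have "m2 - m1 \<le> m1 * (200 * e)" using m(3) by (simp add: algebra_simps)
    ultimately show ?thesis by auto
  qed
  define K0 where "K0 = (+) (- c) ` K"
  have K0_iff: "x \<in> K0 \<longleftrightarrow> c + x \<in> K" for x
    unfolding K0_def by (auto intro: image_eqI[of _ _ "c + x"])
  have K0: "convex_body K0" "symmetric_about 0 K0"
    using recentre[OF K(1,2)] by (simp_all add: K0_def)
  have K_eq: "(+) (- (- c)) ` K0 = K" by (simp add: K0_def image_image)
  have K0_upper: "\<bar>x $ 1\<bar> \<le> 4 / 3 \<and> \<bar>x $ 2\<bar> \<le> 4 / 3" if "x \<in> K0" for x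
  proof -
    have "c + x \<in> K" "c + (- x) \<in> K" using that K0(2) by (auto simp: K0_iff symmetric_about_0)
    from upper[OF this(1)] upper[OF this(2)] show ?thesis using m_bounds by (auto simp: abs_le_iff)
  qed
  have area_K0: "16 / 9 \<le> area K0"
  proof -
    \<comment> \<open>a translate of this square lies in \<open>K\<close>, and so does its reflection in \<open>c\<close>; average them\<close>
    let ?Q = "cbox (vector [- 2 / 3, - 2 / 3]) (vector [- 2 / 3 + 4 / 3, - 2 / 3 + 4 / 3]) :: (real^2) set"
    have "?Q \<subseteq> K0"
    proof
      fix x assume "x \<in> ?Q"
      then have x: "\<bar>x $ 1\<bar> \<le> m1" "\<bar>x $ 2\<bar> \<le> m1"
        using m_bounds by (auto simp: mem_box_cart forall_2)
      have "w1 + x \<in> K" using x by (rule lower)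
      moreover have "2 *\<^sub>R c - (w1 + (- x)) \<in> K" using x by (intro sym lower) simp_all
      ultimately have "(1 / 2) *\<^sub>R (w1 + x) + (1 / 2) *\<^sub>R (2 *\<^sub>R c - (w1 + (- x))) \<in> K"
        using K(1) by (intro convexD) (auto simp: convex_body_def)
      also have "(1 / 2) *\<^sub>R (w1 + x) + (1 / 2) *\<^sub>R (2 *\<^sub>R c - (w1 + (- x))) = c + x"
        by (rule vec2_eqI) (simp_all add: field_simps)
      finally show "x \<in> K0" by (simp add: K0_iff)
    qed
    then have "area ?Q \<le> area K0"
      unfolding area_def using K0(1)
      by (intro measure_mono_fmeasurable) (auto simp: convex_body_def lmeasurable_compact)
    then show ?thesis by (subst (asm) area_box) simp_all
  qed
  define n where "n = \<bar>c $ 1\<bar> + \<bar>c $ 2\<bar>"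
  \<comment> \<open>\<open>D\<close> is the square of side \<open>1 / 4\<close>, away from the axes, in the quadrant that contains \<open>-c\<close>; there
    \<open>x\<close> and \<open>-c\<close> agree in sign, which bounds their inner product from below\<close>
  define lo where "lo t = (if 0 \<le> t then - 3 / 8 else 1 / 8 :: real)" for t :: real
  define D where "D = (cbox (vector [lo (c $ 1), lo (c $ 2)])
      (vector [lo (c $ 1) + 1 / 4, lo (c $ 2) + 1 / 4]) :: (real^2) set)"
  have D_iff: "x \<in> D \<longleftrightarrow> (lo (c $ 1) \<le> x $ 1 \<and> x $ 1 \<le> lo (c $ 1) + 1 / 4) \<and>
     (lo (c $ 2) \<le> x $ 2 \<and> x $ 2 \<le> lo (c $ 2) + 1 / 4)" for x
    by (auto simp: D_def mem_box_cart forall_2)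
  have D_area: "D \<in> lmeasurable" "area D = 1 / 16"
    unfolding D_def by (simp, subst area_box) simp_all
  have D_polar: "D \<subseteq> polar_body K0"
  proof
    fix x assume "x \<in> D"
    then have x: "\<bar>x $ 1\<bar> \<le> 3 / 8" "\<bar>x $ 2\<bar> \<le> 3 / 8"
      by (auto simp: D_iff lo_def abs_le_iff split: if_splits)
    have "x \<bullet> y \<le> 1" if "y \<in> K0" for y
    proof -
      have "x \<bullet> y \<le> \<bar>x $ 1\<bar> * \<bar>y $ 1\<bar> + \<bar>x $ 2\<bar> * \<bar>y $ 2\<bar>"
        unfolding inner_plane by (intro add_mono) (simp_all flip: abs_mult)
      also have "\<dots> \<le> 3 / 8 * (4 / 3) + 3 / 8 * (4 / 3)"
        using x K0_upper[OF that] by (intro add_mono mult_mono) auto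
      finally show ?thesis by simp
    qed
    then show "x \<in> polar_body K0" by (simp add: polar_body_def)
  qed
  have D_lower: "n / 8 \<le> (- c) \<bullet> x" if "x \<in> D" for x
  proof -
    have *: "\<bar>s\<bar> / 8 \<le> (- s) * t" if "lo s \<le> t" "t \<le> lo s + 1 / 4" for s t :: real
    proof (cases "0 \<le> s")
      case True
      then have "s * (1 / 8) \<le> s * (- t)" using that by (intro mult_left_mono) (auto simp: lo_def)
      then show ?thesis using True by simp
    next
      case False
      then have "(- s) * (1 / 8) \<le> (- s) * t" using that by (intro mult_left_mono) (auto simp: lo_def)
      then show ?thesis using False by simp
    qed
    show ?thesis
      using *[of "c $ 1" "x $ 1"] *[of "c $ 2" "x $ 2"] that
      by (simp add: n_def inner_plane D_iff add_divide_distrib)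
  qed
  have shift: "area (polar_body K0) + 6 * (n / 8)\<^sup>2 * area D \<le> area (polar_body K)"
    using area_polar_shift_ge[OF K0, of "- c", unfolded K_eq, OF K(3) D_area(1) D_polar D_lower]
    by (simp add: n_def)
  have "area K = area K0"
    unfolding K0_def area_def by (rule measure_translation[symmetric])
  then have "area K0 * (area (polar_body K0) + 6 * (n / 8)\<^sup>2 * area D) \<le> (1 + e) * 8"
    using mult_left_mono[OF shift, of "area K0"] vp by (simp add: area_def)
  then have "area K0 * (6 * (n / 8)\<^sup>2 * area D) \<le> 8 * e"
    using symmetric_body_mahler[OF K0] by (simp add: algebra_simps)
  moreover have "16 / 9 * (6 * (n / 8)\<^sup>2 * area D) \<le> area K0 * (6 * (n / 8)\<^sup>2 * area D)"
    using area_K0 D_area(2) by (intro mult_right_mono) auto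
  ultimately have "n\<^sup>2 \<le> 768 * e" by (simp add: D_area(2) power_divide)
  also have "\<dots> \<le> (28 * sqrt e)\<^sup>2" using e by (simp add: power_mult_distrib)
  finally have n: "n \<le> 28 * sqrt e" by (rule power2_le_imp_le) (use e in simp)
  have "e \<le> sqrt e"
  proof (rule real_le_rsqrt)
    show "e\<^sup>2 \<le> e" using e mult_left_le[of e e] by (simp add: power2_eq_square)
  qed
  then show ?thesis using near n unfolding n_def by (auto simp: abs_le_iff)
qed

lemma volume_product_recentre_le:
  assumes K: "convex_body K" "symmetric_about c K" "0 \<in> interior K"
  defines "K0 \<equiv> (+) (- c) ` K"
  shows "area K0 * area (polar_body K0) \<le> area K * area (polar_body K)"
proof -
  note K0 = recentre[OF K(1,2), folded K0_def]
  have K_eq: "(+) (- (- c)) ` K0 = K" by (simp add: K0_def image_image)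
  have "area (polar_body K0) \<le> area (polar_body K)"
    using area_polar_shift_ge[OF K0, of "- c" "{}" 0, unfolded K_eq, OF K(3)] by simp
  moreover have "area K0 = area K" unfolding K0_def area_def by (rule measure_translation)
  ultimately show "area K0 * area (polar_body K0) \<le> area K * area (polar_body K)"
    by (simp add: mult_left_mono area_def)
qed

lemma banach_mazur_bound:
  assumes K: "convex_body K" "symmetric_about c K" "0 \<in> interior K"
    and e: "0 < e" and vp: "area K * area (polar_body K) \<le> (1 + e) * 8" and P: "parallelogram P"
  shows "banach_mazur K P \<le> 1 + 200 * e"
proof -
  note K0 = recentre[OF K(1,2)] volume_product_recentre_le[OF K]
  obtain r where r: "0 < r" "r \<le> 1 + 200 * e" "between_parallelograms r ((+) (- c) ` K)"
    using symmetric_body_stability[OF K0(1,2) e] K0(3) vp by force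
  have "r \<in> bm_ratios K P" by (rule bm_ratio_of_between[OF r(1,3) P])
  moreover have "bdd_below (bm_ratios K P)"
    by (rule bdd_belowI[of _ 0]) (simp add: bm_ratios_iff)
  ultimately have "banach_mazur K P \<le> r"
    unfolding banach_mazur_def by (rule cInf_lower)
  then show ?thesis using r(2) by simp
qed

section \<open>Squares in a Euclidean structure\<close>

lemma cross_nonzero_of_orthogonal:
  assumes B: "inner_product B" and "u \<noteq> 0" "B u v = 0" "induced_norm B u = induced_norm B v"
  shows "cross u v \<noteq> 0"
proof
  assume 0: "cross u v = 0"
  have lin: "linear (\<lambda>x. B u x)" using B by (simp add: inner_product_def bilinear_def)
  have pos: "0 < B u u" using B assms(2) by (simp add: inner_product_def)
  have "v $ i = 0" for i
  proof -
    have "v $ i *\<^sub>R u = u $ i *\<^sub>R v"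
      using 0 exhaust_2[of i] by (auto intro!: vec2_eqI simp: cross_def algebra_simps)
    then have "B u (v $ i *\<^sub>R u) = B u (u $ i *\<^sub>R v)" by simp
    then have "v $ i * B u u = u $ i * B u v" by (simp add: linear_scale[OF lin])
    then show ?thesis using assms(3) pos by simp
  qed
  then have "v = 0" by (simp add: vec_eq_iff)
  then have "B u u = B u 0" using assms(4) linear_0[OF lin] B
    by (auto simp: induced_norm_def inner_product_def bilinear_def linear_0)
  then show False using pos linear_0[OF lin] by simp
qed

lemma induced_norm_orthogonal:
  assumes B: "inner_product B" and "B u v = 0" "induced_norm B u = induced_norm B v"
  shows "induced_norm B (s *\<^sub>R u + t *\<^sub>R v) = sqrt ((s\<^sup>2 + t\<^sup>2) * B u u)"
proof -
  have bl: "bilinear B" and comm: "B v u = B u v" using B by (auto simp: inner_product_def)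
  have "B v v = B u u" using assms(3) by (simp add: induced_norm_def)
  then show ?thesis
    unfolding induced_norm_def
    by (simp add: bilinear_ladd[OF bl] bilinear_radd[OF bl] bilinear_lmul[OF bl] bilinear_rmul[OF bl]
      comm assms(2) power2_eq_square algebra_simps)
qed

text \<open>The diagonal \<open>u + v\<close> of the square has squared length \<open>2 * B u u\<close>. The upper bound for all distances
  is needed as well, since a supremum of an unbounded set would carry no information.\<close>

lemma square_side_le:
  assumes B: "inner_product B" "B u v = 0" "induced_norm B u = induced_norm B v"
    and d: "diameter_wrt B (parallelogram_at a u v) = 1"
  shows "B u u \<le> 1 / 2"
proof -
  let ?S = "parallelogram_at a u v"
  have nn: "0 \<le> B u u"
    using B(1) by (cases "u = 0") (auto simp: inner_product_def bilinear_lzero less_imp_le)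
  have bound: "induced_norm B (x - y) \<le> sqrt (2 * B u u)" if xy: "x \<in> ?S" "y \<in> ?S" for x y
  proof -
    obtain s t where x: "0 \<le> s" "s \<le> 1" "0 \<le> t" "t \<le> 1" "x = a + s *\<^sub>R u + t *\<^sub>R v"
      using xy(1) by (auto simp: parallelogram_at_def)
    obtain s' t' where y: "0 \<le> s'" "s' \<le> 1" "0 \<le> t'" "t' \<le> 1" "y = a + s' *\<^sub>R u + t' *\<^sub>R v"
      using xy(2) by (auto simp: parallelogram_at_def)
    have "x - y = (s - s') *\<^sub>R u + (t - t') *\<^sub>R v" by (simp add: x(5) y(5) algebra_simps)
    moreover have "(s - s')\<^sup>2 \<le> 1" "(t - t')\<^sup>2 \<le> 1"
      using x(1-4) y(1-4) by (simp_all add: abs_square_le_1 abs_le_iff)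
    ultimately show ?thesis
      using nn by (simp add: induced_norm_orthogonal[OF B] mult_right_mono)
  qed
  have "bdd_above ((\<lambda>(x, y). induced_norm B (x - y)) ` (?S \<times> ?S))"
    using bound by (intro bdd_aboveI[of _ "sqrt (2 * B u u)"]) auto
  moreover have "(a + u + v, a) \<in> ?S \<times> ?S"
  proof -
    have "a + 1 *\<^sub>R u + 1 *\<^sub>R v \<in> ?S" "a + 0 *\<^sub>R u + 0 *\<^sub>R v \<in> ?S"
      unfolding parallelogram_at_def by fastforce+
    then show ?thesis by simp
  qed
  ultimately have "(\<lambda>(x, y). induced_norm B (x - y)) (a + u + v, a) \<le> diameter_wrt B ?S"
    unfolding diameter_wrt_def by (rule cSUP_upper[rotated])
  then have "induced_norm B (1 *\<^sub>R u + 1 *\<^sub>R v) \<le> 1" by (simp add: d)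
  then show ?thesis using induced_norm_orthogonal[OF B, of 1 1] by simp
qed

text \<open>Were \<open>c\<close> not \<open>m\<close>, the reflection in \<open>c\<close> would move one of two opposite corners out of the
  parallelogram.\<close>

lemma centre_unique:
  assumes uv: "cross u v \<noteq> 0"
    and sym: "symmetric_about c {frame u v y + m | y. \<bar>y $ 1\<bar> \<le> 1 \<and> \<bar>y $ 2\<bar> \<le> 1}"
  shows "c = m"
proof -
  define d where "d = coords u v (c - m)"
  have c: "c = frame u v d + m" by (simp add: d_def frame_coords[OF uv])
  have key: "\<bar>2 * d $ 1 - y $ 1\<bar> \<le> 1 \<and> \<bar>2 * d $ 2 - y $ 2\<bar> \<le> 1"
    if y: "\<bar>y $ 1\<bar> \<le> 1 \<and> \<bar>y $ 2\<bar> \<le> 1" for y :: "real^2"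
  proof -
    have "frame u v y + m \<in> {frame u v y + m | y. \<bar>y $ 1\<bar> \<le> 1 \<and> \<bar>y $ 2\<bar> \<le> 1}" using y by blast
    then have "2 *\<^sub>R c - (frame u v y + m) \<in> {frame u v y + m | y. \<bar>y $ 1\<bar> \<le> 1 \<and> \<bar>y $ 2\<bar> \<le> 1}"
      using sym unfolding symmetric_about_def by blast
    then obtain y' where y': "2 *\<^sub>R c - (frame u v y + m) = frame u v y' + m" "\<bar>y' $ 1\<bar> \<le> 1" "\<bar>y' $ 2\<bar> \<le> 1"
      by blast
    have "frame u v (2 *\<^sub>R d - y) = 2 *\<^sub>R c - (frame u v y + m) - m"
      unfolding c linear_diff[OF linear_frame] linear_scale[OF linear_frame] by (simp add: scaleR_2)
    then have "frame u v (2 *\<^sub>R d - y) = frame u v y'" using y'(1) by simp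
    then have "2 *\<^sub>R d - y = y'" by (rule injD[OF inj_frame[OF uv]])
    then show ?thesis using y'(2,3) by auto
  qed
  have "d $ 1 = 0" "d $ 2 = 0"
    using key[of "vector [1, 1]"] key[of "vector [- 1, - 1]"] by (auto simp: abs_le_iff)
  then show ?thesis by (simp add: c frame_def)
qed

text \<open>Half the sides \<open>u\<close>, \<open>v\<close> of the square of diameter \<open>1\<close> serve as coordinate vectors. In these
  coordinates the norm of \<open>B\<close> is at most the sum norm divided by \<open>2\<close>, and \<open>centre_offset_bound\<close> applies.\<close>

lemma centre_bound:
  assumes K: "convex_body K" "centrally_symmetric K" "0 \<in> interior K"
    and e: "0 < e" "1 + 200 * e < 2" and vp: "area K * area (polar_body K) \<le> (1 + e) * 8"
    and l: "0 < l1" "0 < l2" "l2 / l1 \<le> 1 + 200 * e"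
    and lower: "(+) x ` (*\<^sub>R) l1 ` P \<subseteq> K" and upper: "K \<subseteq> (+) x ` (*\<^sub>R) l2 ` P"
    and B: "inner_product B" and sq: "square_wrt B ((*\<^sub>R) ((l1 + l2) / 2) ` P)"
    and diam: "diameter_wrt B ((*\<^sub>R) ((l1 + l2) / 2) ` P) = 1"
    and c: "symmetric_about c ((+) x ` (*\<^sub>R) ((l1 + l2) / 2) ` P)"
  shows "induced_norm B c \<le> 336 * sqrt e"
proof -
  obtain k where k: "symmetric_about k K" using K(2) by (auto simp: centrally_symmetric_def)
  define l where "l = (l1 + l2) / 2"
  have l0: "0 < l" using assms by (simp add: l_def)
  obtain a u v where uv: "u \<noteq> 0" "B u v = 0" "induced_norm B u = induced_norm B v"
    and S: "(*\<^sub>R) l ` P = parallelogram_at a u v"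
    using sq unfolding square_wrt_def l_def by blast
  define p q m where "p = u /\<^sub>R 2" and "q = v /\<^sub>R 2" and "m = a + u /\<^sub>R 2 + v /\<^sub>R 2"
  have cuv: "cross u v \<noteq> 0" by (rule cross_nonzero_of_orthogonal[OF B uv])
  then have pq: "cross p q \<noteq> 0" by (simp add: p_def q_def cross_def field_simps)
  let ?F = "frame p q" and ?G = "coords p q"
  have Fadd: "?F (y + z) = ?F y + ?F z" for y z by (rule linear_add[OF linear_frame])
  have Fscale: "?F (s *\<^sub>R y) = s *\<^sub>R ?F y" for s y by (rule linear_scale[OF linear_frame])
  have SF: "(*\<^sub>R) l ` P = {?F y + m | y. \<bar>y $ 1\<bar> \<le> 1 \<and> \<bar>y $ 2\<bar> \<le> 1}"
    unfolding S parallelogram_centred p_def q_def m_def ..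
  \<comment> \<open>membership in a scaled copy of \<open>P\<close>, read in coordinates\<close>
  have scaled: "w \<in> (*\<^sub>R) s ` P \<longleftrightarrow> (\<exists>y. \<bar>y $ 1\<bar> \<le> 1 \<and> \<bar>y $ 2\<bar> \<le> 1 \<and> w = (s / l) *\<^sub>R (?F y + m))" for w s
  proof -
    have "P = (\<lambda>z. (1 / l) *\<^sub>R z) ` (*\<^sub>R) l ` P" using l0 by (simp add: image_image)
    then have "(*\<^sub>R) s ` P = (\<lambda>z. (s / l) *\<^sub>R z) ` ((*\<^sub>R) l ` P)"
      by (metis (no_types, lifting) image_image image_cong scaleR_scaleR times_divide_eq_right mult.right_neutral)
    then show ?thesis unfolding SF by auto
  qed
  define m1 m2 where "m1 = l1 / l" and "m2 = l2 / l"
  have mm: "m1 + m2 = 2" "0 < m1" "0 < m2" "m2 \<le> m1 * (1 + 200 * e)"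
  proof -
    have "l1 + l2 = 2 * l" by (simp add: l_def)
    then show "m1 + m2 = 2" using l0 by (simp add: m1_def m2_def flip: add_divide_distrib)
    show "0 < m1" "0 < m2" using l l0 by (simp_all add: m1_def m2_def)
    have "l2 \<le> l1 * (1 + 200 * e)" using l by (simp add: divide_le_eq mult.commute)
    then have "l2 / l \<le> l1 * (1 + 200 * e) / l" using l0 by (simp add: divide_right_mono)
    then show "m2 \<le> m1 * (1 + 200 * e)" by (simp add: m1_def m2_def)
  qed
  define w1 w2 where "w1 = ?G (x + m1 *\<^sub>R m)" and "w2 = ?G (x + m2 *\<^sub>R m)"
  have Fw: "?F w1 = x + m1 *\<^sub>R m" "?F w2 = x + m2 *\<^sub>R m"
    by (simp_all add: w1_def w2_def frame_coords[OF pq])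
  define K' where "K' = ?G ` K"
  have K'_iff: "y \<in> K' \<longleftrightarrow> ?F y \<in> K" for y by (simp add: K'_def preimage_frame_eq[OF pq])
  have K': "convex_body K'" "symmetric_about (?G k) K'" "0 \<in> interior K'"
    "area K' * area (polar_body K') \<le> (1 + e) * 8"
    unfolding K'_def
    using convex_body_coords[OF pq K(1)] symmetric_about_coords[OF k] interior_coords[OF pq K(3)]
      volume_product_coords[OF pq K(1,3)] vp by simp_all
  have offset: "\<bar>w1 $ 1 + w2 $ 1\<bar> + \<bar>w1 $ 2 + w2 $ 2\<bar> \<le> 1344 * sqrt e"
  proof (rule centre_offset_bound[OF K' e(1) _ mm(1,2,4)])
    show "200 * e < 1" using e by simp
    fix y :: "real^2" assume y: "\<bar>y $ 1\<bar> \<le> m1" "\<bar>y $ 2\<bar> \<le> m1"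
    have "?F (w1 + y) = x + m1 *\<^sub>R (?F ((1 / m1) *\<^sub>R y) + m)"
      using mm(2) by (simp add: Fadd Fscale Fw scaleR_add_right)
    moreover have "m1 *\<^sub>R (?F ((1 / m1) *\<^sub>R y) + m) \<in> (*\<^sub>R) l1 ` P"
      unfolding scaled m1_def[symmetric] using y mm(2)
      by (intro exI[of _ "(1 / m1) *\<^sub>R y"]) (simp add: abs_mult)
    ultimately show "w1 + y \<in> K'" using lower by (auto simp: K'_iff)
  next
    fix z assume "z \<in> K'"
    then have "?F z \<in> (+) x ` (*\<^sub>R) l2 ` P" using upper by (auto simp: K'_iff)
    then obtain w where w: "w \<in> (*\<^sub>R) l2 ` P" "?F z = x + w" by auto
    from w(1) obtain y where y: "\<bar>y $ 1\<bar> \<le> 1" "\<bar>y $ 2\<bar> \<le> 1" "w = m2 *\<^sub>R (?F y + m)"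
      unfolding scaled m2_def[symmetric] by blast
    have "?F z = ?F (w2 + m2 *\<^sub>R y)" by (simp add: w(2) y(3) Fadd Fscale Fw scaleR_add_right)
    then have "z = w2 + m2 *\<^sub>R y" by (rule injD[OF inj_frame[OF pq]])
    then show "\<bar>z $ 1 - w2 $ 1\<bar> \<le> m2 \<and> \<bar>z $ 2 - w2 $ 2\<bar> \<le> m2"
      using y(1,2) mm(3) by (simp add: abs_mult)
  qed
  have "c = x + m"
  proof (rule centre_unique[OF pq])
    have "(+) x ` (*\<^sub>R) l ` P = {?F y + (x + m) | y. \<bar>y $ 1\<bar> \<le> 1 \<and> \<bar>y $ 2\<bar> \<le> 1}"
    proof -
      have "x + (?F y + m) = ?F y + (x + m)" for y by simp
      then show ?thesis unfolding SF by (simp only: setcompr_eq_image image_image) 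
    qed
    then show "symmetric_about c {?F y + (x + m) | y. \<bar>y $ 1\<bar> \<le> 1 \<and> \<bar>y $ 2\<bar> \<le> 1}"
      using c by (simp add: l_def)
  qed
  define s where "s = w1 + w2"
  have "?F s = 2 *\<^sub>R x + (m1 + m2) *\<^sub>R m" by (simp add: s_def Fadd Fw scaleR_2 scaleR_add_left)
  also have "\<dots> = 2 *\<^sub>R c" by (simp add: \<open>c = x + m\<close> mm(1) scaleR_add_right)
  finally have Fs: "?F s = 2 *\<^sub>R c" .
  have c_eq: "c = (s $ 1 / 4) *\<^sub>R u + (s $ 2 / 4) *\<^sub>R v"
    using arg_cong[OF Fs, of "\<lambda>z. z $ 1"] arg_cong[OF Fs, of "\<lambda>z. z $ 2"]
    by (intro vec2_eqI) (simp_all add: frame_def p_def q_def)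
  have Buu: "B u u \<le> 1 / 2"
    using diam unfolding l_def[symmetric] S by (rule square_side_le[OF B uv(2,3)])
  have nn: "0 < B u u" using B uv(1) by (simp add: inner_product_def)
  have "induced_norm B c = sqrt (((s $ 1 / 4)\<^sup>2 + (s $ 2 / 4)\<^sup>2) * B u u)"
    unfolding c_eq by (rule induced_norm_orthogonal[OF B uv(2,3)])
  also have "\<dots> \<le> sqrt (((s $ 1 / 4)\<^sup>2 + (s $ 2 / 4)\<^sup>2) * 1)"
    using Buu by (intro real_sqrt_le_mono mult_left_mono) auto
  also have "\<dots> \<le> \<bar>s $ 1 / 4\<bar> + \<bar>s $ 2 / 4\<bar>"
    unfolding mult_1_right by (rule sqrt_sum_squares_le_sum_abs)
  also have "\<dots> \<le> 336 * sqrt e"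
    using offset unfolding s_def by simp
  finally show ?thesis .
qed

theorem theorem1:
  fixes K :: "(real^2) set" and \<epsilon> :: real
  assumes "convex_body K" and "centrally_symmetric K" and "0 \<in> interior K"
    and "0 < \<epsilon>" and "area K * area (polar_body K) \<le> (1 + \<epsilon>) * 8"
  shows "(\<forall>P. parallelogram P \<longrightarrow> banach_mazur K P \<le> 1 + 200 * \<epsilon>) \<and>
    (\<forall>P x l1 l2 B c. parallelogram P \<and> 0 < l1 \<and> 0 < l2 \<and>
       (+) x ` (*\<^sub>R) l1 ` P \<subseteq> K \<and> K \<subseteq> (+) x ` (*\<^sub>R) l2 ` P \<and>
       l2 / l1 \<le> 1 + 200 * \<epsilon> \<and> 1 + 200 * \<epsilon> < 2 \<and>
       inner_product B \<and> square_wrt B ((*\<^sub>R) ((l1 + l2) / 2) ` P) \<and>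
       diameter_wrt B ((*\<^sub>R) ((l1 + l2) / 2) ` P) = 1 \<and>
       symmetric_about c ((+) x ` (*\<^sub>R) ((l1 + l2) / 2) ` P)
       \<longrightarrow> induced_norm B (c - 0) \<le> 336 * sqrt \<epsilon>)"
proof (intro conjI allI impI)
  fix P assume "parallelogram P"
  obtain c where "symmetric_about c K" using assms(2) by (auto simp: centrally_symmetric_def)
  then show "banach_mazur K P \<le> 1 + 200 * \<epsilon>"
    using banach_mazur_bound[OF assms(1) _ assms(3,4,5) \<open>parallelogram P\<close>] by blast
next
  fix P x l1 l2 B c
  assume h: "parallelogram P \<and> 0 < l1 \<and> 0 < l2 \<and>
       (+) x ` (*\<^sub>R) l1 ` P \<subseteq> K \<and> K \<subseteq> (+) x ` (*\<^sub>R) l2 ` P \<and>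
       l2 / l1 \<le> 1 + 200 * \<epsilon> \<and> 1 + 200 * \<epsilon> < 2 \<and>
       inner_product B \<and> square_wrt B ((*\<^sub>R) ((l1 + l2) / 2) ` P) \<and>
       diameter_wrt B ((*\<^sub>R) ((l1 + l2) / 2) ` P) = 1 \<and>
       symmetric_about c ((+) x ` (*\<^sub>R) ((l1 + l2) / 2) ` P)"
  then have "induced_norm B c \<le> 336 * sqrt \<epsilon>"
    by (intro centre_bound[OF assms(1,2,3,4) _ assms(5), of l1 l2 x P B c]) blast+
  then show "induced_norm B (c - 0) \<le> 336 * sqrt \<epsilon>" by simp
qed

end
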